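(* In the asymmetric case (respectively, in the symmetric case), for any $\mu \in (0, 1)$ and any integers $r_1 \ge r_* \ge 1$ and $$r_2 \ge \frac{r_* \mu + r_1}{1 - \mu},$$ there are integers $d$ and $n$, a matrix $M_* \in \mathbb{R}^{d \times d}$ (resp. $M_* \in \mathbb{S}_d^+$) with rank $r_*$ and $\sigma_1(M_* ) = \sigma_{r_*}(M_* ) = 1$, and a linear operator $\mathcal{A} \colon \mathbb{R}^{d \times d} \to \mathbb{R}^n$ (resp. $\mathcal{A} \colon \mathbb{S}_d \to \mathbb{R}^n$) such that the following hold: - $L_k(\mathcal{A}) = 1$ and $\mu_k(\mathcal{A}) > 0$ for all $k \ge 1$, and $\mu_{r_1 + r_*}(\mathcal{A}) = \mu$. - For any $\lambda \ge 0$, there exists $\xi \in \mathbb{R}^n$ with $\|\mathcal{A}^*(\xi)\|_{\mathrm{op}} = \lambda$ such that, with $b = \mathcal{A}(M_* ) + \xi$ and $\phi(M) = \frac{1}{2} \|\mathcal{A}(M) - b\|^2$, $M_*$ is the unique global optimum of the convex problem $\min_{M \in \mathbb{R}^{d \times d}} \phi(M) + \lambda \|M\|_{\mathrm{nuc}}$ (resp. $\min_{M \in \mathbb{S}_d^+} \phi(M) + \lambda \operatorname{tr} M$), and moreover, with this $\phi$ and $\lambda$: - (Asymmetric case) the function $f_\lambda(U, V) = \phi(U V^\top) + \lambda \frac{\|U\|_F^2 + \|V\|_F^2}{2}$ on $\mathbb{R}^{d \times r_2} \times \mathbb{R}^{d \times r_2}$ has a local minimum $(U, V)$ with $U \ne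 0$, $V \ne 0$ such that $U^\top M_* = 0$ and $M_* V = 0$; or, respectively, - (Symmetric case) the function $f_\lambda(U) = \phi(U U^\top) + \lambda \|U\|_F^2$ on $\mathbb{R}^{d \times r_2}$ has a local minimum $U \ne 0$ with $M_* U = 0$.
   Context: $\mathbb{S}_d$ is the space of symmetric $d \times d$ real matrices and $\mathbb{S}_d^+$ the set of positive semidefinite ones. $\sigma_j(M)$ is the $j$th largest singular value; $\|\cdot\|_F$, $\|\cdot\|_{\mathrm{nuc}}$, $\|\cdot\|_{\mathrm{op}}$ are the Frobenius, nuclear, and operator norms; $\|\cdot\|$ is the Euclidean norm on $\mathbb{R}^n$. $\mathcal{A}^*$ is the adjoint with respect to the trace inner product on matrices ($\mathcal{A}^* \colon \mathbb{R}^n \to \mathbb{R}^{d\times d}$, resp. $\mathbb{R}^n \to \mathbb{S}_d$). For an integer $k \ge 1$, $\mu_k(\mathcal{A})$ and $L_k(\mathcal{A})$ denote the largest $\mu \ge 0$ and smallest $L$ such that $\mu \|E\|_F^2 \le \|\mathcal{A}(E)\|^2 \le L \|E\|_F^2$ for all $E \in \mathbb{R}^{d \times d}$ (resp. $E \in \mathbb{S}_d$) with $\operatorname{rank}(E) \le k$. *)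

theory Defs
  imports
    Complex_Main
    "Jordan_Normal_Form.Matrix"
    "Jordan_Normal_Form.Char_Poly"
    "Jordan_Normal_Form.DL_Rank"
begin

definition sym_mats :: "nat \<Rightarrow> real mat set" where
  "sym_mats d = {M \<in> carrier_mat d d. transpose_mat M = M}"

definition psd_mats :: "nat \<Rightarrow> real mat set" where
  "psd_mats d = {M \<in> sym_mats d. \<forall>x \<in> carrier_vec d. 0 \<le> x \<bullet> (M *\<^sub>v x)}"

definition mat_rank :: "real mat \<Rightarrow> nat" where
  "mat_rank M = vec_space.rank (dim_row M) M"

definition mat_trace :: "real mat \<Rightarrow> real" where
  "mat_trace M = (\<Sum>i<dim_row M. M $$ (i, i))"

definition trace_inner :: "real mat \<Rightarrow> real mat \<Rightarrow> real" where
  "trace_inner X Y = mat_trace (transpose_mat X * Y)"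

definition frob_norm :: "real mat \<Rightarrow> real" where
  "frob_norm M = sqrt (trace_inner M M)"

definition vec_norm2 :: "real vec \<Rightarrow> real" where
  "vec_norm2 x = sqrt (x \<bullet> x)"

definition op_norm :: "real mat \<Rightarrow> real" where
  "op_norm M = (SUP x \<in> {x \<in> carrier_vec (dim_col M). vec_norm2 x \<le> 1}. vec_norm2 (M *\<^sub>v x))"

text \<open>The characteristic polynomial of the Gram matrix splits over the reals with nonnegative roots,
  so a square matrix of size d gets a list of exactly d singular values, with multiplicity and in
  decreasing order.  \<open>singular_value M j\<close> is indexed from 1.\<close>

definition singular_values :: "real mat \<Rightarrow> real list" where
  "singular_values M =
     rev (sorted_list_of_multiset (image_mset sqrt (proots (char_poly (transpose_mat M * M)))))"

definition singular_value :: "real mat \<Rightarrow> nat \<Rightarrow> real" where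
  "singular_value M j = singular_values M ! (j - 1)"

definition nuc_norm :: "real mat \<Rightarrow> real" where
  "nuc_norm M = sum_list (singular_values M)"

text \<open>Below, \<open>S\<close> is a linear subspace of the matrices of size d, namely \<open>carrier_mat d d\<close> or
  \<open>sym_mats d\<close>; an operator on \<open>S\<close> is a total function whose values outside \<open>S\<close> are irrelevant.\<close>

definition linear_op :: "real mat set \<Rightarrow> nat \<Rightarrow> (real mat \<Rightarrow> real vec) \<Rightarrow> bool" where
  "linear_op S n A \<longleftrightarrow>
     (\<forall>X \<in> S. A X \<in> carrier_vec n) \<and>
     (\<forall>X \<in> S. \<forall>Y \<in> S. A (X + Y) = A X + A Y) \<and>
     (\<forall>c. \<forall>X \<in> S. A (c \<cdot>\<^sub>m X) = c \<cdot>\<^sub>v A X)"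

definition adjoint_op :: "real mat set \<Rightarrow> (real mat \<Rightarrow> real vec) \<Rightarrow> real vec \<Rightarrow> real mat" where
  "adjoint_op S A \<xi> = (THE X. X \<in> S \<and> (\<forall>E \<in> S. trace_inner X E = \<xi> \<bullet> A E))"

definition mu_const :: "real mat set \<Rightarrow> (real mat \<Rightarrow> real vec) \<Rightarrow> nat \<Rightarrow> real" where
  "mu_const S A k = (GREATEST \<mu>. 0 \<le> \<mu> \<and>
     (\<forall>E \<in> S. mat_rank E \<le> k \<longrightarrow> \<mu> * (frob_norm E)\<^sup>2 \<le> (vec_norm2 (A E))\<^sup>2))"

definition L_const :: "real mat set \<Rightarrow> (real mat \<Rightarrow> real vec) \<Rightarrow> nat \<Rightarrow> real" where
  "L_const S A k = (LEAST L.
     \<forall>E \<in> S. mat_rank E \<le> k \<longrightarrow> (vec_norm2 (A E))\<^sup>2 \<le> L * (frob_norm E)\<^sup>2)"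

definition unique_global_min_on :: "'a set \<Rightarrow> ('a \<Rightarrow> real) \<Rightarrow> 'a \<Rightarrow> bool" where
  "unique_global_min_on D f x \<longleftrightarrow> x \<in> D \<and> (\<forall>y \<in> D. y \<noteq> x \<longrightarrow> f x < f y)"

definition local_min_on :: "('a \<Rightarrow> 'a \<Rightarrow> real) \<Rightarrow> 'a set \<Rightarrow> ('a \<Rightarrow> real) \<Rightarrow> 'a \<Rightarrow> bool" where
  "local_min_on \<delta> D f x \<longleftrightarrow> x \<in> D \<and> (\<exists>\<epsilon>>0. \<forall>y \<in> D. \<delta> x y < \<epsilon> \<longrightarrow> f x \<le> f y)"

definition frob_dist :: "real mat \<Rightarrow> real mat \<Rightarrow> real" where
  "frob_dist X Y = frob_norm (X - Y)"

definition frob_dist_pair :: "real mat \<times> real mat \<Rightarrow> real mat \<times> real mat \<Rightarrow> real" where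
  "frob_dist_pair P Q = sqrt ((frob_dist (fst P) (fst Q))\<^sup>2 + (frob_dist (snd P) (snd Q))\<^sup>2)"

definition lsq_loss :: "(real mat \<Rightarrow> real vec) \<Rightarrow> real vec \<Rightarrow> real mat \<Rightarrow> real" where
  "lsq_loss A b M = (1/2) * (vec_norm2 (A M - b))\<^sup>2"

definition f_asym :: "(real mat \<Rightarrow> real) \<Rightarrow> real \<Rightarrow> real mat \<times> real mat \<Rightarrow> real" where
  "f_asym \<phi> l = (\<lambda>(U, V). \<phi> (U * transpose_mat V) + l * (((frob_norm U)\<^sup>2 + (frob_norm V)\<^sup>2) / 2))"

definition f_sym :: "(real mat \<Rightarrow> real) \<Rightarrow> real \<Rightarrow> real mat \<Rightarrow> real" where
  "f_sym \<phi> l = (\<lambda>U. \<phi> (U * transpose_mat U) + l * (frob_norm U)\<^sup>2)"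

end

theory Submission
  imports Defs "Jordan_Normal_Form.Spectral_Radius" "Jordan_Normal_Form.Schur_Decomposition"
begin

text \<open>
  Let \<open>M = diag(1, \<dots>, 1, 0, \<dots>, 0)\<close> with \<open>r = r\<^sub>*\<close> ones followed by \<open>m = r2\<close> zeros, let
  \<open>g = (-a, \<dots>, -a, 1, \<dots>, 1)\<close> with the same block sizes, and let \<open>A\<close> satisfy
  \<open>\<parallel>A E\<parallel>\<^sup>2 = \<parallel>E\<parallel>\<^sup>2 - c \<langle>diag(g), E\<rangle>\<^sup>2\<close>, where \<open>c \<parallel>g\<parallel>\<^sup>2 < 1\<close> and \<open>a \<ge> 1\<close>.
  A matrix of rank at most \<open>r1 + r\<close> captures at most the \<open>r1 + r\<close> largest entries of \<open>g\<close>, so its worst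
  ratio is \<open>1 - c (a\<^sup>2 r + r1)\<close>, which fixes \<open>c\<close>.

  Choosing \<open>\<xi>\<close> with \<open>A\<^sup>* \<xi> = \<lambda> I\<close> makes the linear noise term cancel the regularizer: up to constants the convex
  objective is \<open>\<parallel>A (X - M)\<parallel>\<^sup>2 / 2 + \<lambda> (\<parallel>X\<parallel>\<^sub>n\<^sub>u\<^sub>c - tr X)\<close>, and the factored one is
  \<open>\<parallel>A (U V\<^sup>T - M)\<parallel>\<^sup>2 / 2 + \<lambda> \<parallel>U - V\<parallel>\<^sup>2 / 2\<close>. So it suffices to find a symmetric local minimum \<open>U = V\<close> of the
  noiseless unregularized loss. Take \<open>\<surd>t\<close> times the identity in the lower block and zero in the upper block;
  this is critical for \<open>t = c (a r + m t)\<close>. In the directions of the range of \<open>M\<close> the gradient is \<open>-(1 - t a)\<close>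
  but the off-diagonal blocks of \<open>U V\<^sup>T\<close> contribute curvature \<open>t\<close>, since all \<open>r2\<close> columns are in use; thus
  \<open>t (1 + a) > 1\<close> gives a local minimum. Together with \<open>c \<parallel>g\<parallel>\<^sup>2 < 1\<close> this leaves a nonempty range for \<open>a\<^sup>2\<close>, just
  above \<open>(r2 (1 - \<mu>) - r1) / (r \<mu>)\<close>, and the hypothesis on \<open>r2\<close> says that this number is at least 1.
\<close>

section \<open>Spectral theorem for real symmetric matrices\<close>

text \<open>Over the complex numbers an eigenvalue \<open>z\<close> exists. Moving the symmetric
  real matrix across the Hermitian product of an eigenvector with itself gives
  \<open>z = cnj z\<close>, so \<open>z\<close> is a real root of the characteristic
  polynomial.\<close>

lemma symmetric_real_eigenvalue:
  fixes A :: "real mat"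
  assumes A: "A \<in> carrier_mat n n" and sym: "A\<^sup>T = A" and n: "n > 0"
  shows "\<exists>e. eigenvalue A e"
proof -
  define C where "C = map_mat complex_of_real A"
  have C: "C \<in> carrier_mat n n" using A by (simp add: C_def)
  have symC: "C\<^sup>T = C" unfolding C_def using sym by (metis map_mat_transpose)
  from spectrum_non_empty[OF C n] obtain z where z: "eigenvalue C z"
    by (auto simp: spectrum_def)
  then obtain v where v: "v \<in> carrier_vec n" "v \<noteq> 0\<^sub>v n" and Cv: "C *\<^sub>v v = z \<cdot>\<^sub>v v"
    using C by (auto simp: eigenvalue_def eigenvector_def)
  have conjC: "conjugate (C *\<^sub>v v) = C *\<^sub>v conjugate v"
    using C v by (intro eq_vecI) (use A in \<open>auto simp: C_def scalar_prod_def row_def\<close>)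
  have "z * (v \<bullet>c v) = (C *\<^sub>v v) \<bullet>c v"
    using v by (simp add: Cv)
  also have "\<dots> = (C\<^sup>T *\<^sub>v v) \<bullet> conjugate v" by (simp add: symC)
  also have "\<dots> = v \<bullet> (C *\<^sub>v conjugate v)"
    using C v by (intro transpose_vec_mult_scalar) auto
  also have "\<dots> = v \<bullet> conjugate (z \<cdot>\<^sub>v v)"
    by (simp add: conjC [symmetric] Cv)
  also have "\<dots> = cnj z * (v \<bullet>c v)"
    using v by (simp add: conjugate_smult_vec)
  finally have "z = cnj z"
    using v by (simp add: conjugate_square_eq_0_vec)
  then have re: "z = complex_of_real (Re z)"
    by (simp add: complex_eq_iff)
  have "poly (char_poly C) z = 0"
    using z eigenvalue_root_char_poly[OF C] by simp
  also have "char_poly C = map_poly complex_of_real (char_poly A)"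
    unfolding C_def by (rule of_real_hom.char_poly_hom[OF A])
  finally have "poly (char_poly A) (Re z) = 0"
    by (subst (asm) re) (simp add: of_real_hom.poly_map_poly)
  then show ?thesis using eigenvalue_root_char_poly[OF A] by blast
qed

text \<open>Gram-Schmidt applied to a basis that starts with \<open>v\<close> keeps the direction of
  its first vector. This supplies the change of basis that splits off one eigenvector in the
  spectral theorem.\<close>

lemma orthogonal_completion:
  fixes v :: "real vec"
  assumes v: "v \<in> carrier_vec n" "v \<noteq> 0\<^sub>v n"
  shows "\<exists>W c. W \<in> carrier_mat n n \<and> W\<^sup>T * W = 1\<^sub>m n \<and> col W 0 = c \<cdot>\<^sub>v v"
proof -
  interpret cof_vec_space n "TYPE(real)" .
  define ws where "ws = gram_schmidt n (basis_completion v)"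
  note bc = basis_completion[OF v]
  note gs = gram_schmidt_result[OF bc(2,4,5) ws_def]
  have len: "length ws = n" using gs(4) bc(6) by simp
  have n: "n > 0" using v by (cases n) auto
  have hd: "ws ! 0 = v"
  proof -
    have "hd ws = v" unfolding ws_def
      using gram_schmidt_hd[OF v(1)] by (simp add: basis_completion_def Let_def)
    then show ?thesis using len n by (cases ws) auto
  qed
  have wsc: "ws ! i \<in> carrier_vec n" if "i < n" for i using gs(3) len that by (metis nth_mem subsetD)
  have orth: "(ws ! i \<bullet> ws ! j = 0) = (i \<noteq> j)" if "i < n" "j < n" for i j
    using corthogonalD[OF gs(2), of i j] that len wsc by (simp add: )
  \<comment> \<open>\<open>gram_schmidt\<close> orthogonalizes without normalizing, so each column
    is divided by its length here.\<close>
  define W where "W = mat n n (\<lambda>(i,j). ws ! j $ i / sqrt (ws ! j \<bullet> ws ! j))"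
  have W: "W \<in> carrier_mat n n" by (simp add: W_def)
  have "W\<^sup>T * W = 1\<^sub>m n"
  proof (rule eq_matI)
    fix i j assume ij: "i < dim_row (1\<^sub>m n :: real mat)" "j < dim_col (1\<^sub>m n :: real mat)"
    then have ij': "i < n" "j < n" by auto
    have "(W\<^sup>T * W) $$ (i,j) = (ws ! i \<bullet> ws ! j) / (sqrt (ws ! i \<bullet> ws ! i) * sqrt (ws ! j \<bullet> ws ! j))"
      using ij' by (simp add: W_def scalar_prod_def sum_divide_distrib carrier_vecD[OF wsc])
    also have "\<dots> = 1\<^sub>m n $$ (i,j)"
    proof (cases "i = j")
      case True
      have "ws ! i \<bullet> ws ! i > 0"
        using orth[of i i] ij' by (simp add: less_le scalar_prod_def sum_nonneg)
      then show ?thesis using True ij' by simp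
    next
      case False
      then show ?thesis using orth ij' by simp
    qed
    finally show "(W\<^sup>T * W) $$ (i,j) = 1\<^sub>m n $$ (i,j)" .
  qed (auto simp: W_def)
  moreover have "col W 0 = (1 / sqrt (v \<bullet> v)) \<cdot>\<^sub>v v"
    using n v by (intro eq_vecI) (auto simp: W_def hd)
  ultimately show ?thesis using W by blast
qed

text \<open>Deflation: in an orthonormal basis whose first vector is an eigenvector, the matrix is
  block diagonal with the eigenvalue in one corner. The induction hypothesis diagonalizes the
  remaining symmetric block.\<close>

theorem real_spectral:
  fixes A :: "real mat"
  assumes "A \<in> carrier_mat n n" and "A\<^sup>T = A"
  shows "\<exists>P f. P \<in> carrier_mat n n \<and> P\<^sup>T * P = 1\<^sub>m n \<and> A = P * mat_diag n f * P\<^sup>T"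
  using assms
proof (induction n arbitrary: A)
  case 0
  then show ?case by (intro exI[of _ "1\<^sub>m 0"] exI) auto
next
  case (Suc n)
  note A = \<open>A \<in> carrier_mat (Suc n) (Suc n)\<close>
  obtain e v where v: "v \<in> carrier_vec (Suc n)" "v \<noteq> 0\<^sub>v (Suc n)" and Av: "A *\<^sub>v v = e \<cdot>\<^sub>v v"
    using symmetric_real_eigenvalue[OF Suc.prems] A
    by (auto simp: eigenvalue_def eigenvector_def)
  obtain W c where W: "W \<in> carrier_mat (Suc n) (Suc n)" and WW: "W\<^sup>T * W = 1\<^sub>m (Suc n)"
    and W0: "col W 0 = c \<cdot>\<^sub>v v"
    using orthogonal_completion[OF v] by blast
  have WW': "W * W\<^sup>T = 1\<^sub>m (Suc n)"
    using mat_mult_left_right_inverse[of "W\<^sup>T" "Suc n" W] W WW by simp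
  define B where "B = W\<^sup>T * A * W"
  have B: "B \<in> carrier_mat (Suc n) (Suc n)" using W A by (simp add: B_def)
  have AB: "A = W * B * W\<^sup>T"
  proof -
    have "W * B * W\<^sup>T = (W * W\<^sup>T) * A * (W * W\<^sup>T)"
      unfolding B_def using W A by (simp add: assoc_mult_mat[of _ "Suc n" "Suc n" _ "Suc n" _ "Suc n"])
    then show ?thesis using A by (simp add: WW')
  qed
  have symB: "B\<^sup>T = B"
    unfolding B_def using W A Suc.prems(2)
    by (simp add: transpose_mult[of _ "Suc n" "Suc n" _ "Suc n"] assoc_mult_mat[of _ "Suc n" "Suc n" _ "Suc n" _ "Suc n"])
  have symB': "B $$ (i,j) = B $$ (j,i)" if "i < Suc n" "j < Suc n" for i j
    using arg_cong[OF symB, of "\<lambda>X. X $$ (j,i)"] B that by simp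
  \<comment> \<open>The first column of \<open>W\<close> is an eigenvector, so conjugation turns it
    into \<open>e\<close> times the first unit vector; symmetry then clears the first row of
    \<open>B\<close> as well.\<close>
  have colB: "B $$ (i,0) = (if i = 0 then e else 0)" if i: "i < Suc n" for i
  proof -
    have "B = W\<^sup>T * (A * W)"
      unfolding B_def using W A by (simp add: assoc_mult_mat[of _ "Suc n" "Suc n" _ "Suc n" _ "Suc n"])
    then have "col B 0 = W\<^sup>T *\<^sub>v col (A * W) 0"
      using col_mult2[of "W\<^sup>T" "Suc n" "Suc n" "A * W" "Suc n" 0] W A by auto
    also have "col (A * W) 0 = A *\<^sub>v col W 0"
      using W A by (intro col_mult2) auto
    also have "A *\<^sub>v col W 0 = e \<cdot>\<^sub>v col W 0"
      unfolding W0 using A v Av by (simp add: mult_mat_vec smult_smult_assoc mult.commute)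
    also have "W\<^sup>T *\<^sub>v (e \<cdot>\<^sub>v col W 0) = e \<cdot>\<^sub>v (W\<^sup>T *\<^sub>v col W 0)"
      using W mult_mat_vec[of "W\<^sup>T" "Suc n" "Suc n" "col W 0" e] by auto
    also have "W\<^sup>T *\<^sub>v col W 0 = col (W\<^sup>T * W) 0"
      using col_mult2[of "W\<^sup>T" "Suc n" "Suc n" W "Suc n" 0] W by auto
    finally have "col B 0 $ i = (e \<cdot>\<^sub>v col (1\<^sub>m (Suc n)) 0) $ i" by (simp only: WW)
    then show ?thesis using i B by simp
  qed
  define B3 where "B3 = mat n n (\<lambda>(i,j). B $$ (Suc i, Suc j))"
  have "B3 \<in> carrier_mat n n" "B3\<^sup>T = B3"
    by (auto simp: B3_def intro!: eq_matI symB')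
  from Suc.IH[OF this] obtain P3 f3 where P3: "P3 \<in> carrier_mat n n" "P3\<^sup>T * P3 = 1\<^sub>m n"
    and B3: "B3 = P3 * mat_diag n f3 * P3\<^sup>T" by blast
  let ?f = "case_nat e f3"
  define R where "R = four_block_mat (1\<^sub>m 1) (0\<^sub>m 1 n) (0\<^sub>m n 1) P3"
  have R: "R \<in> carrier_mat (Suc n) (Suc n)" using P3 by (auto simp: R_def)
  have RT: "R\<^sup>T = four_block_mat (1\<^sub>m 1) (0\<^sub>m 1 n) (0\<^sub>m n 1) (P3\<^sup>T)"
    unfolding R_def using P3 by (subst transpose_four_block_mat) auto
  have one: "four_block_mat (1\<^sub>m 1) (0\<^sub>m 1 n) (0\<^sub>m n 1) (1\<^sub>m n) = (1\<^sub>m (Suc n) :: real mat)"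
    by (intro eq_matI) auto
  have RR: "R\<^sup>T * R = 1\<^sub>m (Suc n)"
    unfolding RT unfolding R_def one[symmetric] using P3
    by (subst mult_four_block_mat[of _ 1 1 _ n _ n _ _ 1 _ n]) (auto)
  have D: "mat_diag (Suc n) ?f = four_block_mat (e \<cdot>\<^sub>m 1\<^sub>m 1) (0\<^sub>m 1 n) (0\<^sub>m n 1) (mat_diag n f3)"
    by (intro eq_matI) (auto simp: mat_diag_def split: nat.splits)
  have BB: "B = four_block_mat (e \<cdot>\<^sub>m 1\<^sub>m 1) (0\<^sub>m 1 n) (0\<^sub>m n 1) B3"
  proof (intro eq_matI)
    fix i j assume "i < dim_row (four_block_mat (e \<cdot>\<^sub>m 1\<^sub>m 1) (0\<^sub>m 1 n) (0\<^sub>m n 1) B3)"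
      "j < dim_col (four_block_mat (e \<cdot>\<^sub>m 1\<^sub>m 1) (0\<^sub>m 1 n) (0\<^sub>m n 1) B3)"
    then have ij: "i < Suc n" "j < Suc n" by (auto simp: B3_def)
    show "B $$ (i,j) = four_block_mat (e \<cdot>\<^sub>m 1\<^sub>m 1) (0\<^sub>m 1 n) (0\<^sub>m n 1) B3 $$ (i,j)"
      using ij colB[of i] colB[of j] symB'[of i j]
      by (cases i; cases j) (auto simp: B3_def)
  qed (use B in \<open>auto simp: B3_def\<close>)
  have z: "0\<^sub>m 1 n * mat_diag n f3 = 0\<^sub>m 1 n" "P3 * mat_diag n f3 * 0\<^sub>m n 1 = 0\<^sub>m n 1"
    "0\<^sub>m 1 n * P3\<^sup>T = 0\<^sub>m 1 n"
    using P3 by (auto intro!: left_mult_zero_mat right_mult_zero_mat mult_carrier_mat)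
  have "R * mat_diag (Suc n) ?f * R\<^sup>T = B"
    unfolding RT unfolding R_def D BB B3 using P3
    by (subst mult_four_block_mat[of _ 1 1 _ n _ n _ _ 1 _ n], auto simp: z[simplified])
       (subst mult_four_block_mat[of _ 1 1 _ n _ n _ _ 1 _ n], auto simp: z[simplified])
  then have "A = W * (R * mat_diag (Suc n) ?f * R\<^sup>T) * W\<^sup>T" using AB by simp
  also have "\<dots> = (W * R) * mat_diag (Suc n) ?f * (W * R)\<^sup>T"
    using W R by (simp add: transpose_mult[of _ "Suc n" "Suc n" _ "Suc n"]
        assoc_mult_mat[of _ "Suc n" "Suc n" _ "Suc n" _ "Suc n"]
        mult_carrier_mat[of _ "Suc n" "Suc n" _ "Suc n"])
  finally have "A = (W * R) * mat_diag (Suc n) ?f * (W * R)\<^sup>T" .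
  moreover have "(W * R)\<^sup>T * (W * R) = 1\<^sub>m (Suc n)"
  proof -
    have "(W * R)\<^sup>T * (W * R) = R\<^sup>T * ((W\<^sup>T * W) * R)"
      using W R by (simp add: transpose_mult[of _ "Suc n" "Suc n" _ "Suc n"]
        assoc_mult_mat[of _ "Suc n" "Suc n" _ "Suc n" _ "Suc n"])
    then show ?thesis using R by (simp add: WW RR)
  qed
  moreover have "W * R \<in> carrier_mat (Suc n) (Suc n)" using W R by simp
  ultimately show ?case by blast
qed

section \<open>Singular values, rank and diagonal functionals\<close>

text \<open>Lagrange's identity: twice the gap between the two sides is the sum of the squares
  \<open>(a i * b j - a j * b i)\<^sup>2\<close>.\<close>

lemma cauchy_schwarz_sum:
  fixes a b :: "'i \<Rightarrow> real"
  shows "(\<Sum>i\<in>S. a i * b i)\<^sup>2 \<le> (\<Sum>i\<in>S. (a i)\<^sup>2) * (\<Sum>i\<in>S. (b i)\<^sup>2)"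
proof -
  have "0 \<le> (\<Sum>i\<in>S. \<Sum>j\<in>S. (a i * b j - a j * b i)\<^sup>2)"
    by (intro sum_nonneg) simp
  also have "\<dots> = (\<Sum>i\<in>S. \<Sum>j\<in>S. (a i)\<^sup>2 * (b j)\<^sup>2 + (b i)\<^sup>2 * (a j)\<^sup>2 - 2 * ((a i * b i) * (a j * b j)))"
    by (intro sum.cong refl) (simp add: power2_eq_square algebra_simps)
  also have "\<dots> = (\<Sum>i\<in>S. \<Sum>j\<in>S. (a i)\<^sup>2 * (b j)\<^sup>2) + (\<Sum>i\<in>S. \<Sum>j\<in>S. (b i)\<^sup>2 * (a j)\<^sup>2)
      - 2 * (\<Sum>i\<in>S. \<Sum>j\<in>S. (a i * b i) * (a j * b j))"
    by (simp only: sum.distrib sum_subtractf sum_distrib_left[symmetric])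
  also have "\<dots> = 2 * ((\<Sum>i\<in>S. (a i)\<^sup>2) * (\<Sum>i\<in>S. (b i)\<^sup>2)) - 2 * (\<Sum>i\<in>S. a i * b i)\<^sup>2"
    by (simp only: sum_product[symmetric] power2_eq_square[of "sum _ _"]) simp
  finally show ?thesis by linarith
qed

lemma square_le_imp_le_sqrt_mult:
  "x\<^sup>2 \<le> y * z \<Longrightarrow> x \<le> sqrt y * sqrt z"
  by (metis real_le_rsqrt real_sqrt_mult)

lemma trace_inner_sum:
  assumes "X \<in> carrier_mat m k" "Y \<in> carrier_mat m k"
  shows "trace_inner X Y = (\<Sum>i<m. \<Sum>j<k. X $$ (i,j) * Y $$ (i,j))"
proof -
  have "trace_inner X Y = (\<Sum>j<k. \<Sum>i<m. X $$ (i,j) * Y $$ (i,j))"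
    using assms by (auto simp: trace_inner_def mat_trace_def scalar_prod_def atLeast0LessThan intro!: sum.cong)
  then show ?thesis by (subst sum.swap)
qed

lemma frob_norm_square:
  assumes "X \<in> carrier_mat m k"
  shows "(frob_norm X)\<^sup>2 = (\<Sum>i<m. \<Sum>j<k. (X $$ (i,j))\<^sup>2)"
  unfolding frob_norm_def trace_inner_sum[OF assms assms]
  by (simp add: sum_nonneg power2_eq_square)

section \<open>Singular value decomposition via the Gram matrix\<close>

lemma gram_decomposition:
  fixes X :: "real mat"
  assumes X: "X \<in> carrier_mat d d"
  obtains P f where "P \<in> carrier_mat d d" "P\<^sup>T * P = 1\<^sub>m d"
    "X\<^sup>T * X = P * mat_diag d f * P\<^sup>T"
proof -
  have "X\<^sup>T * X \<in> carrier_mat d d" "(X\<^sup>T * X)\<^sup>T = X\<^sup>T * X"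
    using X by (auto simp: transpose_mult[of _ d d _ d])
  from real_spectral[OF this] show ?thesis using that by blast
qed

context
  fixes X P :: "real mat" and f :: "nat \<Rightarrow> real" and d :: nat
  assumes X: "X \<in> carrier_mat d d" and P: "P \<in> carrier_mat d d" and PP: "P\<^sup>T * P = 1\<^sub>m d"
    and gram: "X\<^sup>T * X = P * mat_diag d f * P\<^sup>T"
begin

lemma gram_PPT: "P * P\<^sup>T = 1\<^sub>m d"
  using mat_mult_left_right_inverse[of "P\<^sup>T" d P] P PP by simp

text \<open>This makes \<open>X = (X * P) * P\<^sup>T\<close> a singular value decomposition whose
  left vectors are orthogonal but not normalized: column \<open>j\<close> of \<open>X * P\<close>
  has length \<open>sqrt (f j)\<close>. Trace, rank and norms are all read off from it.\<close>

lemma gram_cols: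
  assumes "i < d" "j < d"
  shows "(\<Sum>k<d. (X * P) $$ (k,i) * (X * P) $$ (k,j)) = (if i = j then f j else 0)"
proof -
  have "(X * P)\<^sup>T * (X * P) = P\<^sup>T * (X\<^sup>T * X) * P"
    using X P by (simp add: transpose_mult[of _ d d _ d] assoc_mult_mat[of _ d d _ d _ d])
  also have "\<dots> = (P\<^sup>T * P) * mat_diag d f * (P\<^sup>T * P)"
    unfolding gram using P by (simp add: assoc_mult_mat[of _ d d _ d _ d] mult_carrier_mat[of _ d d _ d])
  also have "\<dots> = mat_diag d f"
    by (simp add: PP left_mult_one_mat[of _ d d] right_mult_one_mat[of _ d d])
  finally have "((X * P)\<^sup>T * (X * P)) $$ (i,j) = mat_diag d f $$ (i,j)" by simp
  moreover have "(Y\<^sup>T * Y) $$ (i,j) = (\<Sum>k<d. Y $$ (k,i) * Y $$ (k,j))" if "Y \<in> carrier_mat d d" for Y :: "real mat"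
    using that assms by (simp add: scalar_prod_def atLeast0LessThan)
  ultimately show ?thesis using assms X P by (simp add: mat_diag_def del: index_mult_mat(1))
qed

lemma gram_eigenvalue_eq: "j < d \<Longrightarrow> f j = (\<Sum>k<d. ((X * P) $$ (k,j))\<^sup>2)"
  using gram_cols[of j j] by (simp add: power2_eq_square)

lemma gram_col_zero:
  assumes "j < d" "f j = 0" "i < d"
  shows "(X * P) $$ (i,j) = 0"
proof -
  have "(\<Sum>k<d. ((X * P) $$ (k,j))\<^sup>2) = 0" using gram_eigenvalue_eq assms by metis
  then show ?thesis using assms by (subst (asm) sum_nonneg_eq_0_iff) (auto simp del: index_mult_mat)
qed

lemma gram_factor_diag:
  assumes "i < d"
  shows "X $$ (i,i) = (\<Sum>j<d. (X * P) $$ (i,j) * P $$ (i,j))"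
proof -
  have "X = (X * P) * P\<^sup>T"
    using X P by (simp add: assoc_mult_mat[of _ d d _ d _ d] gram_PPT)
  then have "X $$ (i,i) = ((X * P) * P\<^sup>T) $$ (i,i)" by (rule arg_cong)
  also have "\<dots> = (\<Sum>j<d. (X * P) $$ (i,j) * P $$ (i,j))"
  proof -
    have "(Y * P\<^sup>T) $$ (i,i) = (\<Sum>j<d. Y $$ (i,j) * P $$ (i,j))" if "Y \<in> carrier_mat d d" for Y
      using that assms P by (simp add: scalar_prod_def atLeast0LessThan)
    then show ?thesis using mult_carrier_mat[OF X P] by blast
  qed
  finally show ?thesis .
qed

lemma gram_frob:
  "(\<Sum>i<d. \<Sum>j<d. ((X * P) $$ (i,j))\<^sup>2) = (\<Sum>i<d. \<Sum>j<d. (X $$ (i,j))\<^sup>2)"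
proof (rule sum.cong[OF refl])
  fix i assume "i \<in> {..<d}"
  then have i: "i < d" by simp
  have "(X * P) * (X * P)\<^sup>T = X * (P * P\<^sup>T) * X\<^sup>T"
    using X P by (simp add: transpose_mult[of _ d d _ d] assoc_mult_mat[of _ d d _ d _ d] mult_carrier_mat[of _ d d _ d])
  also have "\<dots> = X * X\<^sup>T" using X by (simp add: gram_PPT)
  finally have "((X * P) * (X * P)\<^sup>T) $$ (i,i) = (X * X\<^sup>T) $$ (i,i)" by simp
  moreover have "(Y * Y\<^sup>T) $$ (i,i) = (\<Sum>j<d. (Y $$ (i,j))\<^sup>2)" if "Y \<in> carrier_mat d d" for Y :: "real mat"
    using that i by (simp add: scalar_prod_def atLeast0LessThan power2_eq_square)
  ultimately show "(\<Sum>j<d. ((X * P) $$ (i,j))\<^sup>2) = (\<Sum>j<d. (X $$ (i,j))\<^sup>2)"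
    using X P by (metis mult_carrier_mat)
qed

lemma gram_P_col: "j < d \<Longrightarrow> (\<Sum>i<d. (P $$ (i,j))\<^sup>2) = 1"
  using arg_cong[OF PP, of "\<lambda>M. M $$ (j,j)"] P
  by (simp add: scalar_prod_def atLeast0LessThan power2_eq_square)

lemma gram_P_row: "i < d \<Longrightarrow> (\<Sum>j<d. (P $$ (i,j))\<^sup>2) = 1"
  using arg_cong[OF gram_PPT, of "\<lambda>M. M $$ (i,i)"] P
  by (simp add: scalar_prod_def atLeast0LessThan power2_eq_square)

text \<open>Similar matrices share their characteristic polynomial, and that of a diagonal matrix is
  a product of linear factors, whose roots with multiplicity are the entries
  \<open>f j\<close>.\<close>

lemma gram_singular_values:
  "singular_values X = rev (sort (map (\<lambda>j. sqrt (f j)) [0..<d]))"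
proof -
  have "similar_mat_wit (X\<^sup>T * X) (mat_diag d f) P (P\<^sup>T)"
    using X P by (auto simp: similar_mat_wit_def Let_def gram PP gram_PPT)
  then have "similar_mat (X\<^sup>T * X) (mat_diag d f)" unfolding similar_mat_def by blast
  then have "char_poly (X\<^sup>T * X) = char_poly (mat_diag d f)" by (rule char_poly_similar)
  also have "\<dots> = (\<Prod>a\<leftarrow>diag_mat (mat_diag d f). [:- a, 1:])"
    by (intro char_poly_upper_triangular[of _ d]) (auto simp: mat_diag_def upper_triangular_def)
  also have "diag_mat (mat_diag d f) = map f [0..<d]"
    by (auto simp: diag_mat_def mat_diag_def)
  finally have "proots (char_poly (X\<^sup>T * X)) = proots (\<Prod>a\<leftarrow>map f [0..<d]. [:- a, 1:])" by simp
  also have "\<dots> = mset (map f [0..<d])"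
  proof -
    have "proots (\<Prod>a\<leftarrow>xs. [:- a, 1:]) = mset xs" for xs :: "real list"
      by (induction xs) (simp_all add: proots_mult prod_list_zero_iff image_iff del: mult_pCons_left)
    then show ?thesis .
  qed
  finally have "image_mset sqrt (proots (char_poly (X\<^sup>T * X))) = mset (map (\<lambda>j. sqrt (f j)) [0..<d])"
    by (simp add: multiset.map_comp o_def)
  then show ?thesis
    unfolding singular_values_def by (simp only: sorted_list_of_multiset_mset)
qed

lemma gram_nuc_norm: "nuc_norm X = (\<Sum>j<d. sqrt (f j))"
proof -
  have "nuc_norm X = sum_mset (mset (singular_values X))"
    unfolding nuc_norm_def by (rule sum_mset_sum_list[symmetric])
  also have "\<dots> = sum_list (map (\<lambda>j. sqrt (f j)) [0..<d])"
    unfolding gram_singular_values by (simp only: mset_rev mset_sort sum_mset_sum_list)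
  finally show ?thesis by (simp add: sum_list_distinct_conv_sum_set atLeast0LessThan)
qed

text \<open>The trace is the sum over \<open>j\<close> of the inner products of column
  \<open>j\<close> of \<open>X * P\<close> with the unit column \<open>j\<close> of
  \<open>P\<close>; Cauchy-Schwarz bounds each of them by \<open>sqrt (f j)\<close>.\<close>

lemma gram_trace_le: "mat_trace X \<le> nuc_norm X"
proof -
  have "mat_trace X = (\<Sum>i<d. \<Sum>j<d. (X * P) $$ (i,j) * P $$ (i,j))"
    using X unfolding mat_trace_def by (auto simp: gram_factor_diag simp del: index_mult_mat intro!: sum.cong)
  also have "\<dots> = (\<Sum>j<d. \<Sum>i<d. (X * P) $$ (i,j) * P $$ (i,j))" by (rule sum.swap)
  also have "\<dots> \<le> (\<Sum>j<d. sqrt (f j))"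
  proof (rule sum_mono)
    fix j assume "j \<in> {..<d}"
    then have j: "j < d" by simp
    show "(\<Sum>i<d. (X * P) $$ (i,j) * P $$ (i,j)) \<le> sqrt (f j)"
      using square_le_imp_le_sqrt_mult[OF cauchy_schwarz_sum[of "\<lambda>i. (X * P) $$ (i,j)" "\<lambda>i. P $$ (i,j)" "{..<d}"]]
      by (simp add: gram_P_col[OF j] gram_eigenvalue_eq[OF j] del: index_mult_mat)
  qed
  also have "\<dots> = nuc_norm X" by (simp add: gram_nuc_norm)
  finally show ?thesis .
qed

text \<open>Multiplying by the invertible \<open>P\<close> does not change the column space. The
  columns of \<open>X * P\<close> with \<open>f j \<noteq> 0\<close> are orthogonal and nonzero,
  hence independent, and every other column vanishes, so they form a maximal independent set of
  columns.\<close>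

lemma gram_rank: "mat_rank X = card {j. j < d \<and> f j \<noteq> 0}"
proof -
  interpret vec_space "TYPE(real)" d .
  define F where "F = X * P"
  define c where "c = col F"
  let ?J = "{j. j < d \<and> f j \<noteq> 0}"
  have F: "F \<in> carrier_mat d d" using X P by (simp add: F_def)
  have c: "c j \<in> carrier_vec d" for j using F by (simp add: c_def carrier_vecI)
  have cols: "set (cols F) = c ` {..<d}" using F by (auto simp: cols_def c_def)
  have "col_space X = col_space F"
  proof -
    have "\<exists>y \<in> carrier_vec d. F *\<^sub>v y = X *\<^sub>v x" if "x \<in> carrier_vec d" for x
    proof (rule bexI)
      have "F *\<^sub>v (P\<^sup>T *\<^sub>v x) = X *\<^sub>v ((P * P\<^sup>T) *\<^sub>v x)"
        using X P that by (simp add: assoc_mult_mat_vec[of _ d d _ d] F_def)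
      then show "F *\<^sub>v (P\<^sup>T *\<^sub>v x) = X *\<^sub>v x" using that by (simp add: gram_PPT)
    qed (use P that in auto)
    moreover have "\<exists>y \<in> carrier_vec d. X *\<^sub>v y = F *\<^sub>v x" if "x \<in> carrier_vec d" for x
      using X P that by (intro bexI[of _ "P *\<^sub>v x"]) (auto simp: assoc_mult_mat_vec[of _ d d _ d] F_def)
    ultimately show ?thesis
      using X F unfolding col_space_eq[OF X] col_space_eq[OF F] by fastforce
  qed
  then have rk: "mat_rank X = rank F"
    using X by (simp add: mat_rank_def rank_def col_space_def)
  have cc: "c i \<bullet> c j = (if i = j then f j else 0)" if "i < d" "j < d" for i j
    using gram_cols[OF that, folded F_def] F that by (simp add: scalar_prod_def c_def atLeast0LessThan)
  \<comment> \<open>The rank is a cardinality of a set of vectors, so distinct indices have to give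
    distinct columns.\<close>
  have inj: "inj_on c ?J"
  proof
    fix i j assume ij: "i \<in> ?J" "j \<in> ?J" and eq: "c i = c j"
    have "c i \<bullet> c j = f j" unfolding eq using cc[of j j] ij by simp
    then show "i = j" using cc[of i j] ij by (metis (mono_tags, lifting) mem_Collect_eq)
  qed
  have carr: "c ` ?J \<subseteq> carrier_vec d" using c by auto
  have li: "lin_indpt (c ` ?J)"
  proof (rule finite_lin_indpt2)
    show "finite (c ` ?J)" by simp
    show "c ` ?J \<subseteq> carrier_vec d" using c by auto
    fix a :: "real vec \<Rightarrow> real" assume lc: "lincomb a (c ` ?J) = 0\<^sub>v d"
    have "a (c j) = 0" if j: "j \<in> ?J" for j
    proof -
      have "0 = lincomb a (c ` ?J) \<bullet> c j"
        using lc c[of j] by simp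
      also have "\<dots> = (\<Sum>k<d. (\<Sum>i\<in>?J. a (c i) * c i $ k) * c j $ k)"
        using lincomb_index[OF _ carr] carrier_vecD[OF c]
        by (simp add: scalar_prod_def atLeast0LessThan sum.reindex[OF inj] o_def)
      also have "\<dots> = (\<Sum>k<d. \<Sum>i\<in>?J. a (c i) * (c i $ k * c j $ k))"
        by (simp add: sum_distrib_right mult.assoc)
      also have "\<dots> = (\<Sum>i\<in>?J. \<Sum>k<d. a (c i) * (c i $ k * c j $ k))"
        by (rule sum.swap)
      also have "\<dots> = (\<Sum>i\<in>?J. a (c i) * (c i \<bullet> c j))"
        by (simp add: scalar_prod_def atLeast0LessThan sum_distrib_left carrier_vecD[OF c])
      also have "\<dots> = (\<Sum>i\<in>?J. if i = j then a (c j) * f j else 0)"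
        using j by (intro sum.cong refl) (auto simp: cc)
      also have "\<dots> = a (c j) * f j" using j by simp
      finally show ?thesis using j by simp
    qed
    then show "\<forall>v\<in>c ` ?J. a v = 0" by auto
  qed
  have "maximal (c ` ?J) (\<lambda>T. T \<subseteq> set (cols F) \<and> lin_indpt T)"
    unfolding maximal_def
  proof (intro conjI allI impI)
    show "c ` ?J \<subseteq> set (cols F)" unfolding cols by auto
    show "lin_indpt (c ` ?J)" by (rule li)
    fix T assume T: "c ` ?J \<subseteq> T \<and> T \<subseteq> set (cols F) \<and> lin_indpt T"
    have "T \<subseteq> c ` ?J"
    proof
      fix x assume x: "x \<in> T"
      then obtain j where j: "j < d" "x = c j" using T unfolding cols by auto
      have Tc: "T \<subseteq> carrier_vec d" using T c unfolding cols by auto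
      have "(UNIV :: real set) \<noteq> {0}" by (metis UNIV_I singletonD zero_neq_one)
      then have "x \<noteq> 0\<^sub>v d" using zero_nin_lin_indpt[of T] T Tc x by auto
      moreover have "c j = 0\<^sub>v d" if "f j = 0"
        using j F gram_col_zero[of j, folded F_def] that by (auto intro!: eq_vecI simp: c_def)
      ultimately show "x \<in> c ` ?J" using j by auto
    qed
    then show "T = c ` ?J" using T by auto
  qed
  from rank_card_indpt[OF F this] show ?thesis
    using rk card_image[OF inj] by simp
qed

end

lemma trace_le_nuc_norm: "X \<in> carrier_mat d d \<Longrightarrow> mat_trace X \<le> nuc_norm X"
  by (rule gram_decomposition, assumption, rule gram_trace_le)

text \<open>Only the columns of \<open>X * P\<close> indexed by \<open>J\<close>, at most
  \<open>k\<close> of them, contribute. Cauchy-Schwarz leaves the weights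
  \<open>\<Sum>j\<in>J. (P $$ (i,j))\<^sup>2\<close> in front of \<open>(g i)\<^sup>2\<close>; each
  is at most 1 and their total is \<open>card J\<close>. The function \<open>h\<close> bounds the
  excess of \<open>(g i)\<^sup>2\<close> over 1, so the common part costs \<open>k\<close> and the
  excess at most its full sum.\<close>

lemma low_rank_diag_bound:
  fixes X :: "real mat" and g h :: "nat \<Rightarrow> real"
  assumes X: "X \<in> carrier_mat d d" and rank: "mat_rank X \<le> k"
    and gh: "\<And>i. i < d \<Longrightarrow> (g i)\<^sup>2 \<le> 1 + h i" and h: "\<And>i. i < d \<Longrightarrow> 0 \<le> h i"
  shows "(\<Sum>i<d. g i * X $$ (i,i))\<^sup>2 \<le> (real k + (\<Sum>i<d. h i)) * (frob_norm X)\<^sup>2"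
proof -
  obtain P f where P: "P \<in> carrier_mat d d" "P\<^sup>T * P = 1\<^sub>m d" "X\<^sup>T * X = P * mat_diag d f * P\<^sup>T"
    by (rule gram_decomposition[OF X])
  note ctx = X P
  define F where "F = X * P"
  define J where "J = {j. j < d \<and> f j \<noteq> 0}"
  let ?I = "{..<d}"
  have J: "finite J" "J \<subseteq> ?I" by (auto simp: J_def)
  have cardJ: "card J \<le> k" using gram_rank[OF ctx] rank by (simp add: J_def)
  have diag: "X $$ (i,i) = (\<Sum>j\<in>J. F $$ (i,j) * P $$ (i,j))" if "i < d" for i
  proof -
    have "X $$ (i,i) = (\<Sum>j\<in>?I. F $$ (i,j) * P $$ (i,j))"
      unfolding F_def by (rule gram_factor_diag[OF ctx that])
    also have "\<dots> = (\<Sum>j\<in>J. F $$ (i,j) * P $$ (i,j))"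
      using that gram_col_zero[OF ctx, folded F_def]
      by (intro sum.mono_neutral_right) (auto simp: J_def)
    finally show ?thesis .
  qed
  have "(\<Sum>i<d. g i * X $$ (i,i)) = (\<Sum>i<d. \<Sum>j\<in>J. (g i * P $$ (i,j)) * F $$ (i,j))"
    by (intro sum.cong refl) (simp add: diag sum_distrib_left mult_ac)
  also have "\<dots> = (\<Sum>z\<in>?I \<times> J. (g (fst z) * P $$ z) * F $$ z)"
    by (simp add: sum.cartesian_product case_prod_unfold)
  finally have eq: "(\<Sum>i<d. g i * X $$ (i,i)) = (\<Sum>z\<in>?I \<times> J. (g (fst z) * P $$ z) * F $$ z)" .
  have "(\<Sum>i<d. g i * X $$ (i,i))\<^sup>2 \<le>
      (\<Sum>z\<in>?I \<times> J. (g (fst z) * P $$ z)\<^sup>2) * (\<Sum>z\<in>?I \<times> J. (F $$ z)\<^sup>2)"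
    unfolding eq by (rule cauchy_schwarz_sum)
  also have "\<dots> \<le> (real k + (\<Sum>i<d. h i)) * (frob_norm X)\<^sup>2"
  proof (rule mult_mono)
    have "(\<Sum>z\<in>?I \<times> J. (g (fst z) * P $$ z)\<^sup>2) = (\<Sum>i<d. \<Sum>j\<in>J. (g i)\<^sup>2 * (P $$ (i,j))\<^sup>2)"
      by (simp add: sum.cartesian_product case_prod_unfold power_mult_distrib)
    also have "\<dots> \<le> (\<Sum>i<d. \<Sum>j\<in>J. (P $$ (i,j))\<^sup>2 + h i * (P $$ (i,j))\<^sup>2)"
    proof (intro sum_mono)
      fix i j assume "i \<in> ?I"
      then have "(g i)\<^sup>2 * (P $$ (i,j))\<^sup>2 \<le> (1 + h i) * (P $$ (i,j))\<^sup>2"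
        using gh by (intro mult_right_mono) auto
      then show "(g i)\<^sup>2 * (P $$ (i,j))\<^sup>2 \<le> (P $$ (i,j))\<^sup>2 + h i * (P $$ (i,j))\<^sup>2"
        by (simp add: algebra_simps)
    qed
    \<comment> \<open>Summed by columns, the common part uses that columns of \<open>P\<close> are
      unit vectors; summed by rows, the excess uses that its rows are.\<close>
    also have "\<dots> = (\<Sum>j\<in>J. \<Sum>i<d. (P $$ (i,j))\<^sup>2) + (\<Sum>i<d. h i * (\<Sum>j\<in>J. (P $$ (i,j))\<^sup>2))"
      by (subst (2) sum.swap) (simp add: sum.distrib sum_distrib_left)
    also have "(\<Sum>j\<in>J. \<Sum>i<d. (P $$ (i,j))\<^sup>2) = real (card J)"
      using J gram_P_col[OF ctx] by (simp add: subset_iff)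
    also have "(\<Sum>i<d. h i * (\<Sum>j\<in>J. (P $$ (i,j))\<^sup>2)) \<le> (\<Sum>i<d. h i * 1)"
    proof (intro sum_mono mult_left_mono)
      fix i assume i: "i \<in> ?I"
      have "(\<Sum>j\<in>J. (P $$ (i,j))\<^sup>2) \<le> (\<Sum>j<d. (P $$ (i,j))\<^sup>2)"
        using J by (intro sum_mono2) auto
      then show "(\<Sum>j\<in>J. (P $$ (i,j))\<^sup>2) \<le> 1" using gram_P_row[OF ctx] i by simp
    qed (use h in auto)
    finally show "(\<Sum>z\<in>?I \<times> J. (g (fst z) * P $$ z)\<^sup>2) \<le> real k + (\<Sum>i<d. h i)"
      using cardJ by simp
    have "(\<Sum>z\<in>?I \<times> J. (F $$ z)\<^sup>2) \<le> (\<Sum>z\<in>?I \<times> ?I. (F $$ z)\<^sup>2)"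
      using J by (intro sum_mono2) auto
    also have "\<dots> = (frob_norm X)\<^sup>2"
      using gram_frob[OF ctx, folded F_def]
      by (simp add: frob_norm_square[OF X] sum.cartesian_product case_prod_unfold)
    finally show "(\<Sum>z\<in>?I \<times> J. (F $$ z)\<^sup>2) \<le> (frob_norm X)\<^sup>2" .
  qed (use h in \<open>auto intro!: sum_nonneg add_nonneg_nonneg\<close>)
  finally show ?thesis .
qed

text \<open>Brings a diagonal matrix into the form required above with \<open>P\<close> the
  identity, so that its rank and singular values follow by instantiation.\<close>

lemma gram_mat_diag:
  fixes h :: "nat \<Rightarrow> real"
  shows "(mat_diag d h)\<^sup>T * mat_diag d h = 1\<^sub>m d * mat_diag d (\<lambda>i. (h i)\<^sup>2) * (1\<^sub>m d)\<^sup>T"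
proof -
  have "(mat_diag d h)\<^sup>T = mat_diag d h"
    by (intro eq_matI) (auto simp: mat_diag_def)
  then show ?thesis by (simp add: power2_eq_square left_mult_one_mat[of _ d d] right_mult_one_mat[of _ d d])
qed

lemma mat_rank_mat_diag: "mat_rank (mat_diag d h) = card {i. i < d \<and> h i \<noteq> (0::real)}"
  using gram_rank[OF _ _ _ gram_mat_diag] by simp

lemma singular_values_mat_diag:
  "singular_values (mat_diag d h) = rev (sort (map (\<lambda>i. \<bar>h i\<bar>) [0..<d]))"
  using gram_singular_values[OF _ _ _ gram_mat_diag] by simp

lemma nuc_norm_mat_diag: "nuc_norm (mat_diag d h) = (\<Sum>i<d. \<bar>h i\<bar>)"
  using gram_nuc_norm[OF _ _ _ gram_mat_diag] by simp

lemma singular_value_partial_identity: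
  assumes "1 \<le> j" "j \<le> r"
  shows "singular_value (mat_diag (r + m) (\<lambda>i. if i < r then 1 else 0)) j = 1"
proof -
  have "sort (map (\<lambda>i. \<bar>if i < r then 1 else 0 :: real\<bar>) [0..<r+m]) = replicate m 0 @ replicate r 1"
  proof (rule properties_for_sort)
    have "map (\<lambda>i. \<bar>if i < r then 1 else 0 :: real\<bar>) [0..<r+m] = replicate r 1 @ replicate m 0"
      by (intro nth_equalityI) (auto simp: nth_append)
    then show "mset (replicate m 0 @ replicate r 1) = mset (map (\<lambda>i. \<bar>if i < r then 1 else 0 :: real\<bar>) [0..<r+m])"
      by simp
    show "sorted (replicate m 0 @ replicate r (1::real))"
      by (auto simp: sorted_append)
  qed
  then have "singular_values (mat_diag (r + m) (\<lambda>i. if i < r then 1 else 0)) = replicate r 1 @ replicate m 0"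
    unfolding singular_values_mat_diag by simp
  then show ?thesis using assms by (simp add: singular_value_def nth_append)
qed

section \<open>The loss near the spurious point\<close>

lemma sum_lessThan_add: "(\<Sum>i<r+m. f i) = (\<Sum>i<r. f i) + (\<Sum>i<m. f (r+i))"
  for f :: "nat \<Rightarrow> 'a::comm_monoid_add"
  by (induction m) (simp_all add: add.assoc)

text \<open>Writing \<open>T\<close> as \<open>s\<close> times the identity plus a perturbation of
  Frobenius norm at most \<open>e\<close>, the image of \<open>x\<close> is
  \<open>s * x + z\<close>. Its squared norm is at least \<open>s\<^sup>2\<close> times that of
  \<open>x\<close> plus the cross term, and the square of \<open>z\<close> is dropped. This will
  bound the off-diagonal blocks of the product of the factors from below.\<close>

lemma perturbed_scaled_identity_bound:
  fixes x :: "nat \<Rightarrow> real" and T :: "nat \<Rightarrow> nat \<Rightarrow> real"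
  assumes s: "0 \<le> s" and e: "0 \<le> e"
    and T: "(\<Sum>j<m. \<Sum>k<m. (T j k - (if j = k then s else 0))\<^sup>2) \<le> e\<^sup>2"
  shows "(s\<^sup>2 - 2 * s * e) * (\<Sum>k<m. (x k)\<^sup>2) \<le> (\<Sum>j<m. (\<Sum>k<m. x k * T j k)\<^sup>2)"
proof -
  define N where "N = (\<Sum>k<m. (x k)\<^sup>2)"
  have N: "0 \<le> N" by (auto simp: N_def intro: sum_nonneg)
  define z where "z = (\<lambda>j. \<Sum>k<m. x k * (T j k - (if j = k then s else 0)))"
  have Tz: "(\<Sum>k<m. x k * T j k) = s * x j + z j" if "j < m" for j
  proof -
    have "z j = (\<Sum>k<m. x k * T j k) - (\<Sum>k<m. if j = k then s * x k else 0)"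
      unfolding z_def sum_subtractf[symmetric] by (intro sum.cong) (auto simp: algebra_simps)
    then show ?thesis using that by simp
  qed
  have "(\<Sum>j<m. (z j)\<^sup>2) \<le> (\<Sum>j<m. N * (\<Sum>k<m. (T j k - (if j = k then s else 0))\<^sup>2))"
    unfolding z_def N_def by (intro sum_mono cauchy_schwarz_sum)
  also have "\<dots> \<le> N * e\<^sup>2"
    unfolding sum_distrib_left[symmetric] by (intro mult_left_mono T N)
  finally have zz: "(\<Sum>j<m. (z j)\<^sup>2) \<le> N * e\<^sup>2" .
  \<comment> \<open>The minus sign turns the upper bound of Cauchy-Schwarz into a lower bound for
    the inner product of \<open>x\<close> and \<open>z\<close>.\<close>
  have "(\<Sum>j<m. - x j * z j)\<^sup>2 \<le> (\<Sum>j<m. (- x j)\<^sup>2) * (\<Sum>j<m. (z j)\<^sup>2)"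
    by (rule cauchy_schwarz_sum)
  also have "\<dots> \<le> N * (N * e\<^sup>2)"
    using N zz by (auto simp: N_def intro!: mult_left_mono)
  also have "\<dots> = (N * e)\<^sup>2" by (simp add: power2_eq_square)
  finally have "(\<Sum>j<m. - x j * z j) \<le> N * e"
    using N e by (meson mult_nonneg_nonneg power2_le_imp_le)
  then have xz: "- (N * e) \<le> (\<Sum>j<m. x j * z j)"
    by (simp add: sum_negf)
  have "(s\<^sup>2 - 2 * s * e) * N \<le> s\<^sup>2 * N + 2 * s * (\<Sum>j<m. x j * z j)"
    using mult_left_mono[OF xz, of "2 * s"] s by (simp add: algebra_simps)
  also have "\<dots> = (\<Sum>j<m. s\<^sup>2 * (x j)\<^sup>2 + 2 * s * (x j * z j))"
    by (simp add: N_def sum.distrib sum_distrib_left)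
  also have "\<dots> \<le> (\<Sum>j<m. (s * x j + z j)\<^sup>2)"
    by (intro sum_mono) (simp add: power2_sum power_mult_distrib)
  also have "\<dots> = (\<Sum>j<m. (\<Sum>k<m. x k * T j k)\<^sup>2)"
    by (intro sum.cong refl) (simp add: Tz)
  finally show ?thesis by (simp add: N_def)
qed

text \<open>What remains of the local analysis after the block estimates: \<open>p\<close> is the
  inner product of the upper blocks of the factors and \<open>q\<close> that of the lower ones.
  Stationarity of \<open>t\<close> removes the term linear in \<open>y\<close>,
  \<open>c * m < 1\<close> makes the pure square of \<open>y\<close> harmless, and the slack in
  \<open>small\<close> pays for everything that contains \<open>p\<close>.\<close>

lemma scalar_local_bound:
  fixes a c t p q s2 y m rs :: real
  assumes c: "0 < c" and a: "0 < a" and m: "0 < m" and cm: "c * m < 1"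
    and t: "t = c * (a * rs + m * t)" and ta: "t * a < 1"
    and y: "q = m * t + y"
    and small: "c * a * \<bar>y\<bar> + c * a\<^sup>2 * \<bar>p\<bar> / 2 + (1 - t * a) \<le> s2"
  shows "rs + m * t\<^sup>2 - c * (a * rs + m * t)\<^sup>2
       \<le> rs - 2 * p + 2 * s2 * \<bar>p\<bar> + q\<^sup>2 / m - c * (a * rs - a * p + q)\<^sup>2"
proof -
  define D where "D = a * rs + m * t"
  have tD: "t = c * D" using t by (simp add: D_def)
  have "q\<^sup>2 / m = m * t\<^sup>2 + 2 * t * y + y\<^sup>2 / m"
    using m by (simp add: y power2_eq_square field_simps)
  moreover have "c * (a * rs - a * p + q)\<^sup>2 = c * D\<^sup>2 + 2 * t * (y - a * p) + c * (y - a * p)\<^sup>2"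
  proof -
    have "a * rs - a * p + q = D + (y - a * p)" by (simp add: D_def y)
    then show ?thesis by (simp only: power2_sum tD) (simp add: algebra_simps power2_eq_square)
  qed
  ultimately have eq: "(rs - 2 * p + 2 * s2 * \<bar>p\<bar> + q\<^sup>2 / m - c * (a * rs - a * p + q)\<^sup>2)
      - (rs + m * t\<^sup>2 - c * D\<^sup>2) = 2 * s2 * \<bar>p\<bar> - 2 * p * (1 - t * a) + (y\<^sup>2 / m - c * y\<^sup>2)
        + 2 * c * a * (y * p) - c * a\<^sup>2 * p\<^sup>2"
    by (simp add: algebra_simps power2_eq_square)
  have 1: "p * (1 - t * a) \<le> \<bar>p\<bar> * (1 - t * a)" using ta by (intro mult_right_mono) auto
  have 2: "0 \<le> y\<^sup>2 / m - c * y\<^sup>2"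
  proof -
    have "c * m * y\<^sup>2 \<le> 1 * y\<^sup>2" using cm by (intro mult_right_mono) auto
    then show ?thesis using m by (simp add: field_simps)
  qed
  have 3: "- (c * a * (\<bar>y\<bar> * \<bar>p\<bar>)) \<le> c * a * (y * p)"
  proof -
    have "- (\<bar>y\<bar> * \<bar>p\<bar>) \<le> y * p" by (simp add: abs_mult[symmetric])
    from mult_left_mono[OF this, of "c * a"] c a show ?thesis by simp
  qed
  \<comment> \<open>Multiplied by the absolute value of \<open>p\<close>, the smallness condition
    absorbs the gradient in \<open>p\<close>, the mixed term in \<open>y * p\<close> and the
    negative square of \<open>p\<close> at once.\<close>
  have 4: "(c * a * \<bar>y\<bar> + c * a\<^sup>2 * \<bar>p\<bar> / 2 + (1 - t * a)) * \<bar>p\<bar> \<le> s2 * \<bar>p\<bar>"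
    using small by (intro mult_right_mono) auto
  then have 5: "c * a * (\<bar>y\<bar> * \<bar>p\<bar>) + c * a\<^sup>2 * p\<^sup>2 / 2 + \<bar>p\<bar> * (1 - t * a) \<le> s2 * \<bar>p\<bar>"
    by (simp add: algebra_simps power2_eq_square)
  have "0 \<le> 2 * (s2 * \<bar>p\<bar>) - 2 * (p * (1 - t * a)) + (y\<^sup>2 / m - c * y\<^sup>2)
        + 2 * (c * a * (y * p)) - c * a\<^sup>2 * p\<^sup>2"
    using 1 2 3 5 by linarith
  then have "0 \<le> 2 * s2 * \<bar>p\<bar> - 2 * p * (1 - t * a) + (y\<^sup>2 / m - c * y\<^sup>2)
        + 2 * c * a * (y * p) - c * a\<^sup>2 * p\<^sup>2"
    by (simp add: mult.assoc)
  with eq show ?thesis unfolding D_def by linarith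
qed

text \<open>The value of \<open>\<parallel>A (U V\<^sup>T - M)\<parallel>\<^sup>2\<close>, in terms of the entries of \<open>U\<close> and \<open>V\<close>, for the operator and the
  matrix of locale \<open>spurious_model\<close> below.\<close>

definition factor_loss :: "real \<Rightarrow> real \<Rightarrow> nat \<Rightarrow> nat \<Rightarrow> (nat \<Rightarrow> nat \<Rightarrow> real) \<Rightarrow> (nat \<Rightarrow> nat \<Rightarrow> real) \<Rightarrow> real" where
  "factor_loss c a r m u v =
     (\<Sum>i<r+m. \<Sum>j<r+m. ((\<Sum>k<m. u i k * v j k) - (if i = j \<and> i < r then 1 else 0))\<^sup>2)
     - c * (\<Sum>i<r+m. (if i < r then - a else 1) * ((\<Sum>k<m. u i k * v i k) - (if i < r then 1 else 0)))\<^sup>2"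

text \<open>The four sums are the blocks of the product matrix. The two off-diagonal blocks are
  written with the index of the upper rows outermost, so that each inner double sum is one
  application of \<open>perturbed_scaled_identity_bound\<close>.\<close>

lemma factor_loss_split:
  "factor_loss c a r m u v =
     (\<Sum>i<r. \<Sum>j<r. ((\<Sum>k<m. u i k * v j k) - (if i = j then 1 else 0))\<^sup>2)
     + (\<Sum>i<r. \<Sum>j<m. (\<Sum>k<m. u i k * v (r+j) k)\<^sup>2)
     + (\<Sum>j<r. \<Sum>i<m. (\<Sum>k<m. u (r+i) k * v j k)\<^sup>2)
     + (\<Sum>i<m. \<Sum>j<m. (\<Sum>k<m. u (r+i) k * v (r+j) k)\<^sup>2)
     - c * (a * r - a * (\<Sum>i<r. \<Sum>k<m. u i k * v i k) + (\<Sum>i<m. \<Sum>k<m. u (r+i) k * v (r+i) k))\<^sup>2"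
proof -
  have 1: "(\<Sum>i<r+m. \<Sum>j<r+m. ((\<Sum>k<m. u i k * v j k) - (if i = j \<and> i < r then 1 else 0))\<^sup>2) =
     (\<Sum>i<r. \<Sum>j<r. ((\<Sum>k<m. u i k * v j k) - (if i = j then 1 else 0))\<^sup>2)
     + (\<Sum>i<m. \<Sum>j<r. (\<Sum>k<m. u (r+i) k * v j k)\<^sup>2)
     + ((\<Sum>i<r. \<Sum>j<m. (\<Sum>k<m. u i k * v (r+j) k)\<^sup>2)
     + (\<Sum>i<m. \<Sum>j<m. (\<Sum>k<m. u (r+i) k * v (r+j) k)\<^sup>2))"
    unfolding sum_lessThan_add sum.distrib by (intro arg_cong2[of _ _ _ _ "(+)"] sum.cong refl) auto
  have 2: "(\<Sum>i<r+m. (if i < r then - a else 1) * ((\<Sum>k<m. u i k * v i k) - (if i < r then 1 else 0)))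
     = a * r - a * (\<Sum>i<r. \<Sum>k<m. u i k * v i k) + (\<Sum>i<m. \<Sum>k<m. u (r+i) k * v (r+i) k)"
    unfolding sum_lessThan_add by (simp add: sum_distrib_left algebra_simps sum.distrib sum_subtractf sum_negf)
  show ?thesis unfolding factor_loss_def 1 2
    by (subst (2) sum.swap) (simp add: add_ac)
qed

text \<open>The common value of both factors at the nonzero local minimum.\<close>

definition spurious :: "real \<Rightarrow> nat \<Rightarrow> nat \<Rightarrow> nat \<Rightarrow> real" where
  "spurious t r i k = (if i = r + k then sqrt t else 0)"

lemma factor_loss_spurious:
  assumes "0 \<le> t"
  shows "factor_loss c a r m (spurious t r) (spurious t r) = r + m * t\<^sup>2 - c * (a * r + m * t)\<^sup>2"
proof -
  have z: "(\<Sum>k<m. spurious t r i k * v k) = 0" if "i < r" for i v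
    using that by (simp add: spurious_def)
  have z': "(\<Sum>k<m. v k * spurious t r i k) = 0" if "i < r" for i v
    using that by (simp add: spurious_def)
  have n: "(\<Sum>k<m. spurious t r (r+i) k * spurious t r (r+j) k) = (if i = j then t else 0)" if "i < m" for i j
  proof -
    have "(\<Sum>k<m. spurious t r (r+i) k * spurious t r (r+j) k) = (\<Sum>k<m. if i = k then (if i = j then t else 0) else 0)"
      using assms by (intro sum.cong) (auto simp: spurious_def)
    then show ?thesis using that by simp
  qed
  show ?thesis unfolding factor_loss_split
    by (simp add: z z' n if_distrib[of "\<lambda>x. x\<^sup>2"] cong: if_cong)
qed

text \<open>Each block is bounded separately: the upper one by \<open>r - 2 * p\<close>, the lower
  one by \<open>q\<^sup>2 / m\<close>, and the off-diagonal ones by \<open>s2 * nu\<close> and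
  \<open>s2 * nv\<close>, which together dominate \<open>2 * s2 * \<bar>p\<bar>\<close>. Then
  \<open>scalar_local_bound\<close> applies. The factors \<open>u\<close> and \<open>v\<close> vary
  independently.\<close>

lemma factor_loss_local_bound:
  fixes t a c e :: real and r m :: nat
  assumes c: "0 < c" and a: "0 < a" and m: "0 < m" and cm: "c * m < 1"
    and t: "t = c * (a * r + m * t)" and t0: "0 < t" and ta: "t * a < 1"
    and e: "0 \<le> e" "e \<le> 1"
    and small: "e * (4 * sqrt t + 2 * c * a * (2 * sqrt t * sqrt m + 1) + c * a\<^sup>2) \<le> 2 * (t * (1 + a) - 1)"
    and u: "(\<Sum>i<r+m. \<Sum>k<m. (u i k - spurious t r i k)\<^sup>2) \<le> e\<^sup>2"
    and v: "(\<Sum>i<r+m. \<Sum>k<m. (v i k - spurious t r i k)\<^sup>2) \<le> e\<^sup>2"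
  shows "factor_loss c a r m (spurious t r) (spurious t r) \<le> factor_loss c a r m u v"
proof -
  define s where "s = sqrt t"
  have s: "0 \<le> s" "s\<^sup>2 = t" using t0 by (auto simp: s_def)
  define nu where "nu = (\<Sum>i<r. \<Sum>k<m. (u i k)\<^sup>2)"
  define nv where "nv = (\<Sum>i<r. \<Sum>k<m. (v i k)\<^sup>2)"
  \<comment> \<open>Deviation of the lower block of a factor from \<open>sqrt t\<close> times the
    identity.\<close>
  define S where "S = (\<lambda>w i k. w (r+i) k - (if i = k then s else 0) :: real)"
  have split: "(\<Sum>i<r+m. \<Sum>k<m. (w i k - spurious t r i k)\<^sup>2)
      = (\<Sum>i<r. \<Sum>k<m. (w i k)\<^sup>2) + (\<Sum>i<m. \<Sum>k<m. (S w i k)\<^sup>2)" for w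
    unfolding sum_lessThan_add by (simp add: spurious_def S_def s_def cong: if_cong)
  have nn: "0 \<le> (\<Sum>i<m. \<Sum>k<m. (S w i k)\<^sup>2)" for w by (intro sum_nonneg) auto
  have nu0: "0 \<le> nu" and nv0: "0 \<le> nv" by (auto simp: nu_def nv_def intro!: sum_nonneg)
  have nu: "nu \<le> e\<^sup>2" and Su: "(\<Sum>i<m. \<Sum>k<m. (S u i k)\<^sup>2) \<le> e\<^sup>2"
    using u nn[of u] nu0 unfolding split nu_def by linarith+
  have nv: "nv \<le> e\<^sup>2" and Sv: "(\<Sum>i<m. \<Sum>k<m. (S v i k)\<^sup>2) \<le> e\<^sup>2"
    using v nn[of v] nv0 unfolding split nv_def by linarith+
  define p where "p = (\<Sum>i<r. \<Sum>k<m. u i k * v i k)"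
  define q where "q = (\<Sum>i<m. \<Sum>k<m. u (r+i) k * v (r+i) k)"
  define y where "y = q - m * t"
  define s2 where "s2 = t - 2 * s * e"
  have p: "2 * \<bar>p\<bar> \<le> nu + nv"
  proof -
    have "0 \<le> (\<Sum>i<r. \<Sum>k<m. (u i k + v i k)\<^sup>2)" "0 \<le> (\<Sum>i<r. \<Sum>k<m. (u i k - v i k)\<^sup>2)"
      by (auto intro!: sum_nonneg)
    then have "0 \<le> nu + nv + 2 * p" "0 \<le> nu + nv - 2 * p"
      unfolding nu_def nv_def p_def
      by (simp_all add: power2_sum power2_diff sum.distrib sum_subtractf sum_distrib_left mult.assoc)
    then show ?thesis by linarith
  qed
  have y_bound: "\<bar>y\<bar> \<le> (2 * s * sqrt m + 1) * e"
  proof -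
    have tr: "\<bar>\<Sum>i<m. S w i i\<bar> \<le> sqrt m * e" if "(\<Sum>i<m. \<Sum>k<m. (S w i k)\<^sup>2) \<le> e\<^sup>2" for w
    proof -
      have "(\<Sum>i<m. 1 * S w i i)\<^sup>2 \<le> (\<Sum>i<m. 1\<^sup>2) * (\<Sum>i<m. (S w i i)\<^sup>2)"
        by (rule cauchy_schwarz_sum)
      also have "\<dots> \<le> m * e\<^sup>2"
      proof -
        have "(\<Sum>i<m. (S w i i)\<^sup>2) \<le> (\<Sum>i<m. \<Sum>k<m. (S w i k)\<^sup>2)"
          by (intro sum_mono member_le_sum) auto
        then show ?thesis using that by (auto intro!: mult_left_mono)
      qed
      also have "\<dots> = (sqrt m * e)\<^sup>2" by (simp add: power_mult_distrib)
      finally have "\<bar>\<Sum>i<m. 1 * S w i i\<bar> \<le> \<bar>sqrt m * e\<bar>" by (simp only: abs_le_square_iff)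
      then show ?thesis using e by simp
    qed
    have SS: "\<bar>\<Sum>i<m. \<Sum>k<m. S u i k * S v i k\<bar> \<le> e * e"
    proof -
      have "(\<Sum>z\<in>{..<m}\<times>{..<m}. (case z of (i,k) \<Rightarrow> S u i k) * (case z of (i,k) \<Rightarrow> S v i k))\<^sup>2
        \<le> (\<Sum>z\<in>{..<m}\<times>{..<m}. (case z of (i,k) \<Rightarrow> S u i k)\<^sup>2) * (\<Sum>z\<in>{..<m}\<times>{..<m}. (case z of (i,k) \<Rightarrow> S v i k)\<^sup>2)"
        by (rule cauchy_schwarz_sum)
      then have "(\<Sum>i<m. \<Sum>k<m. S u i k * S v i k)\<^sup>2 \<le> (\<Sum>i<m. \<Sum>k<m. (S u i k)\<^sup>2) * (\<Sum>i<m. \<Sum>k<m. (S v i k)\<^sup>2)"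
        by (simp add: sum.cartesian_product case_prod_unfold)
      also have "\<dots> \<le> e\<^sup>2 * e\<^sup>2" using Su Sv nn by (intro mult_mono) auto
      also have "\<dots> = (e * e)\<^sup>2" by (simp add: power2_eq_square)
      finally have "\<bar>\<Sum>i<m. \<Sum>k<m. S u i k * S v i k\<bar> \<le> \<bar>e * e\<bar>" by (simp only: abs_le_square_iff)
      then show ?thesis using e by simp
    qed
    \<comment> \<open>Expanding the product of \<open>s\<close> times the identity plus the two
      deviations: the first-order part consists of their traces, the second-order part of their
      inner product.\<close>
    have "q = (\<Sum>i<m. t + s * (S u i i + S v i i) + (\<Sum>k<m. S u i k * S v i k))"
    proof (unfold q_def, intro sum.cong refl)
      fix i assume i: "i \<in> {..<m}"
      have "(\<Sum>k<m. u (r+i) k * v (r+i) k) = (\<Sum>k<m. (if i = k then t + s * (S u i i + S v i i) else 0) + S u i k * S v i k)"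
        by (intro sum.cong refl) (auto simp: S_def algebra_simps s(2)[symmetric] power2_eq_square)
      then show "(\<Sum>k<m. u (r+i) k * v (r+i) k) = t + s * (S u i i + S v i i) + (\<Sum>k<m. S u i k * S v i k)"
        using i by (simp add: sum.distrib)
    qed
    then have y: "y = s * (\<Sum>i<m. S u i i) + s * (\<Sum>i<m. S v i i) + (\<Sum>i<m. \<Sum>k<m. S u i k * S v i k)"
      unfolding y_def by (simp add: sum.distrib sum_distrib_left distrib_left)
    have "\<bar>y\<bar> \<le> s * \<bar>\<Sum>i<m. S u i i\<bar> + s * \<bar>\<Sum>i<m. S v i i\<bar> + \<bar>\<Sum>i<m. \<Sum>k<m. S u i k * S v i k\<bar>"
    proof -
      have sx: "s * \<bar>x\<bar> = \<bar>s * x\<bar>" for x :: real using s by (simp add: abs_mult)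
      show ?thesis unfolding y sx by linarith
    qed
    also have "\<dots> \<le> s * (sqrt m * e) + s * (sqrt m * e) + e * 1"
      using mult_left_mono[OF tr[OF Su] s(1)] mult_left_mono[OF tr[OF Sv] s(1)] SS
        mult_left_mono[OF e(2) e(1)] by linarith
    finally show ?thesis by (simp add: algebra_simps)
  qed
  \<comment> \<open>Off-diagonal entries are discarded, and on the diagonal the square of the
    product entry is dropped.\<close>
  have b1: "r - 2 * p \<le> (\<Sum>i<r. \<Sum>j<r. ((\<Sum>k<m. u i k * v j k) - (if i = j then 1 else 0))\<^sup>2)"
  proof -
    have "r - 2 * p = (\<Sum>i<r. \<Sum>j<r. if i = j then 1 - 2 * (\<Sum>k<m. u i k * v i k) else 0)"
      by (simp add: p_def sum_subtractf sum_distrib_left)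
    also have "\<dots> \<le> (\<Sum>i<r. \<Sum>j<r. ((\<Sum>k<m. u i k * v j k) - (if i = j then 1 else 0))\<^sup>2)"
      by (intro sum_mono) (auto simp: power2_diff)
    finally show ?thesis .
  qed
  have b2: "s2 * nu \<le> (\<Sum>i<r. \<Sum>j<m. (\<Sum>k<m. u i k * v (r+j) k)\<^sup>2)"
    unfolding nu_def sum_distrib_left[of s2 _ "{..<r}"]
    unfolding s2_def s(2)[symmetric]
    using perturbed_scaled_identity_bound[OF s(1) e(1) Sv[unfolded S_def]] by (intro sum_mono) blast
  have b3: "s2 * nv \<le> (\<Sum>j<r. \<Sum>i<m. (\<Sum>k<m. u (r+i) k * v j k)\<^sup>2)"
    unfolding nv_def sum_distrib_left[of s2 _ "{..<r}"]
    unfolding s2_def s(2)[symmetric]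
    using perturbed_scaled_identity_bound[OF s(1) e(1) Su[unfolded S_def], of "v _"]
    by (intro sum_mono) (simp add: mult.commute)
  \<comment> \<open>Only the diagonal of the lower block is kept; Cauchy-Schwarz compares its sum of
    squares with the square of its trace \<open>q\<close>.\<close>
  have b4: "q\<^sup>2 / m \<le> (\<Sum>i<m. \<Sum>j<m. (\<Sum>k<m. u (r+i) k * v (r+j) k)\<^sup>2)"
  proof -
    have "q\<^sup>2 = (\<Sum>i<m. 1 * (\<Sum>k<m. u (r+i) k * v (r+i) k))\<^sup>2" by (simp add: q_def)
    also have "\<dots> \<le> (\<Sum>i<m. 1\<^sup>2) * (\<Sum>i<m. (\<Sum>k<m. u (r+i) k * v (r+i) k)\<^sup>2)"
      by (rule cauchy_schwarz_sum)
    also have "\<dots> \<le> m * (\<Sum>i<m. \<Sum>j<m. (\<Sum>k<m. u (r+i) k * v (r+j) k)\<^sup>2)"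
    proof -
      have "(\<Sum>k<m. u (r+i) k * v (r+i) k)\<^sup>2 \<le> (\<Sum>j<m. (\<Sum>k<m. u (r+i) k * v (r+j) k)\<^sup>2)" if "i < m" for i
        using that member_le_sum[of i "{..<m}" "\<lambda>j. (\<Sum>k<m. u (r+i) k * v (r+j) k)\<^sup>2"] by auto
      then show ?thesis by (auto intro!: mult_left_mono sum_mono)
    qed
    finally show ?thesis using m by (simp add: divide_le_eq mult.commute)
  qed
  \<comment> \<open>Since \<open>e \<le> 1\<close>, second-order errors are replaced by first-order
    ones, which keeps the smallness condition linear in \<open>e\<close>.\<close>
  have ee: "e\<^sup>2 \<le> e" using mult_left_mono[OF e(2) e(1)] by (simp add: power2_eq_square)
  have pe: "\<bar>p\<bar> \<le> e" using p nu nv ee by linarith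
  \<comment> \<open>With the bounds on \<open>y\<close> and \<open>p\<close> inserted and
    \<open>s2\<close> expanded, this is half of the hypothesis \<open>small\<close>.\<close>
  have small': "c * a * \<bar>y\<bar> + c * a\<^sup>2 * \<bar>p\<bar> / 2 + (1 - t * a) \<le> s2"
  proof -
    have "c * a * \<bar>y\<bar> \<le> c * a * ((2 * s * sqrt m + 1) * e)"
      using y_bound c a by (intro mult_left_mono) auto
    moreover have "c * a\<^sup>2 * \<bar>p\<bar> \<le> c * a\<^sup>2 * e"
      using pe c by (intro mult_left_mono) auto
    ultimately show ?thesis
      using small unfolding s2_def s_def[symmetric] by (simp add: algebra_simps)
  qed
  have s2: "0 \<le> s2"
  proof -
    have "0 \<le> c * a * \<bar>y\<bar>" "0 \<le> c * a\<^sup>2 * \<bar>p\<bar> / 2" using c a by auto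
    then show ?thesis using small' ta by linarith
  qed
  have "factor_loss c a r m (spurious t r) (spurious t r) \<le> r - 2 * p + 2 * s2 * \<bar>p\<bar> + q\<^sup>2 / m - c * (a * r - a * p + q)\<^sup>2"
    using scalar_local_bound[OF c a _ cm t ta _ small', of q] m t0
    by (simp add: factor_loss_spurious y_def)
  also have "\<dots> \<le> factor_loss c a r m u v"
    unfolding factor_loss_split p_def[symmetric] q_def[symmetric]
    using b1 b2 b3 b4 mult_left_mono[OF p s2] by (simp add: algebra_simps)
  finally show ?thesis .
qed

section \<open>The measurement operator\<close>

lemma mu_const_eqI:
  assumes "0 \<le> \<mu>"
    and "\<And>E. E \<in> S \<Longrightarrow> mat_rank E \<le> k \<Longrightarrow> \<mu> * (frob_norm E)\<^sup>2 \<le> (vec_norm2 (A E))\<^sup>2"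
    and "E0 \<in> S" "mat_rank E0 \<le> k" "(vec_norm2 (A E0))\<^sup>2 = \<mu> * (frob_norm E0)\<^sup>2" "frob_norm E0 \<noteq> 0"
  shows "mu_const S A k = \<mu>"
  unfolding mu_const_def
proof (rule Greatest_equality)
  fix \<nu> assume "0 \<le> \<nu> \<and> (\<forall>E\<in>S. mat_rank E \<le> k \<longrightarrow> \<nu> * (frob_norm E)\<^sup>2 \<le> (vec_norm2 (A E))\<^sup>2)"
  then have "\<nu> * (frob_norm E0)\<^sup>2 \<le> \<mu> * (frob_norm E0)\<^sup>2" using assms by metis
  then show "\<nu> \<le> \<mu>" using assms(6) by simp
qed (use assms in auto)

text \<open>\<open>GREATEST\<close> carries information only if a maximum exists. The admissible
  constants are bounded above by the ratio at the nonzero \<open>E0\<close>, and their supremum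
  still satisfies each defining inequality, so it is the maximum.\<close>

lemma mu_const_lower_bound:
  assumes \<mu>: "0 \<le> \<mu>"
    and bound: "\<And>E. E \<in> S \<Longrightarrow> mat_rank E \<le> k \<Longrightarrow> \<mu> * (frob_norm E)\<^sup>2 \<le> (vec_norm2 (A E))\<^sup>2"
    and E0: "E0 \<in> S" "mat_rank E0 \<le> k" "frob_norm E0 \<noteq> 0"
  shows "\<mu> \<le> mu_const S A k"
proof -
  define T where "T = {\<mu>. 0 \<le> \<mu> \<and> (\<forall>E\<in>S. mat_rank E \<le> k \<longrightarrow> \<mu> * (frob_norm E)\<^sup>2 \<le> (vec_norm2 (A E))\<^sup>2)}"
  have ne: "\<mu> \<in> T" using \<mu> bound by (auto simp: T_def)
  have ub: "\<nu> \<le> (vec_norm2 (A E))\<^sup>2 / (frob_norm E)\<^sup>2"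
    if "\<nu> \<in> T" "E \<in> S" "mat_rank E \<le> k" "frob_norm E \<noteq> 0" for \<nu> E
    using that by (auto simp: T_def field_simps)
  have bdd: "bdd_above T" using ub[OF _ E0] by (auto simp: bdd_above_def)
  have "Sup T \<in> T"
  proof -
    have "0 \<le> Sup T" using cSup_upper[OF ne bdd] \<mu> by linarith
    moreover have "Sup T * (frob_norm E)\<^sup>2 \<le> (vec_norm2 (A E))\<^sup>2" if E: "E \<in> S" "mat_rank E \<le> k" for E
    proof (cases "frob_norm E = 0")
      case False
      then have "Sup T \<le> (vec_norm2 (A E))\<^sup>2 / (frob_norm E)\<^sup>2"
        using ne ub E by (intro cSup_least) auto
      then show ?thesis using False by (simp add: field_simps)
    qed auto
    ultimately show ?thesis by (simp add: T_def)
  qed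
  then have "mu_const S A k = Sup T"
    unfolding mu_const_def using cSup_upper[OF _ bdd]
    by (intro Greatest_equality) (auto simp: T_def)
  then show ?thesis using cSup_upper[OF ne bdd] by simp
qed

lemma L_const_eqI:
  assumes "\<And>E. E \<in> S \<Longrightarrow> mat_rank E \<le> k \<Longrightarrow> (vec_norm2 (A E))\<^sup>2 \<le> L * (frob_norm E)\<^sup>2"
    and "E0 \<in> S" "mat_rank E0 \<le> k" "(vec_norm2 (A E0))\<^sup>2 = L * (frob_norm E0)\<^sup>2" "frob_norm E0 \<noteq> 0"
  shows "L_const S A k = L"
  unfolding L_const_def
proof (rule Least_equality)
  fix \<nu> assume "\<forall>E\<in>S. mat_rank E \<le> k \<longrightarrow> (vec_norm2 (A E))\<^sup>2 \<le> \<nu> * (frob_norm E)\<^sup>2"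
  then have "L * (frob_norm E0)\<^sup>2 \<le> \<nu> * (frob_norm E0)\<^sup>2" using assms by metis
  then show "L \<le> \<nu>" using assms(5) by simp
qed (use assms in auto)

lemma op_norm_scaled_identity:
  assumes "0 \<le> l" "0 < d"
  shows "op_norm (l \<cdot>\<^sub>m 1\<^sub>m d) = l"
proof -
  let ?B = "{x \<in> carrier_vec d. vec_norm2 x \<le> 1}"
  have app: "vec_norm2 ((l \<cdot>\<^sub>m 1\<^sub>m d) *\<^sub>v x) = l * vec_norm2 x" if "x \<in> carrier_vec d" for x
  proof -
    have "(\<Sum>k=0..<d. l * (if k = i then 1 else 0) * x $ k) = l * x $ i" if "i < d" for i
    proof -
      have "(\<Sum>k=0..<d. l * (if k = i then 1 else 0) * x $ k) = (\<Sum>k=0..<d. if k = i then l * x $ i else 0)"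
        by (intro sum.cong) auto
      then show ?thesis using that by simp
    qed
    then have "(l \<cdot>\<^sub>m 1\<^sub>m d) *\<^sub>v x = l \<cdot>\<^sub>v x" using that
      by (intro eq_vecI) (auto simp: scalar_prod_def)
    then show ?thesis using that assms
      by (simp add: vec_norm2_def real_sqrt_mult)
  qed
  have un: "vec_norm2 (unit_vec d 0) = 1" using assms by (simp add: vec_norm2_def)
  have "(SUP x\<in>?B. vec_norm2 ((l \<cdot>\<^sub>m 1\<^sub>m d) *\<^sub>v x)) = l"
  proof (rule cSup_eq_maximum)
    show "l \<in> (\<lambda>x. vec_norm2 ((l \<cdot>\<^sub>m 1\<^sub>m d) *\<^sub>v x)) ` ?B"
      by (rule image_eqI[of _ _ "unit_vec d 0"]) (simp_all add: app un)
    fix y assume "y \<in> (\<lambda>x. vec_norm2 ((l \<cdot>\<^sub>m 1\<^sub>m d) *\<^sub>v x)) ` ?B"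
    then show "y \<le> l" using assms by (auto simp: app intro: mult_left_le)
  qed
  then show ?thesis by (simp add: op_norm_def)
qed

text \<open>Row-major flattening: entry \<open>(i,j)\<close> sits at position
  \<open>i * d + j\<close>. Through it sums over the vector \<open>A X\<close> become sums over
  matrix entries.\<close>

lemma sum_div_mod:
  fixes h :: "nat \<Rightarrow> nat \<Rightarrow> 'a::comm_monoid_add"
  shows "(\<Sum>n<d*d. h (n div d) (n mod d)) = (\<Sum>i<d. \<Sum>j<d. h i j)"
proof (cases "d = 0")
  case False
  have "(\<Sum>n<d*d. h (n div d) (n mod d)) = (\<Sum>i<d. \<Sum>n\<in>{i*d..<i*d+d}. h (n div d) (n mod d))"
    by (rule sum.nat_group[symmetric])
  also have "\<dots> = (\<Sum>i<d. \<Sum>j<d. h i j)"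
  proof (rule sum.cong[OF refl])
    fix i
    have "(\<Sum>n\<in>{i*d..<i*d+d}. h (n div d) (n mod d)) = (\<Sum>n\<in>{0+i*d..<d+i*d}. h (n div d) (n mod d))"
      by (simp add: add.commute)
    also have "\<dots> = (\<Sum>j\<in>{0..<d}. h ((j+i*d) div d) ((j+i*d) mod d))"
      by (rule sum.shift_bounds_nat_ivl)
    also have "\<dots> = (\<Sum>j<d. h i j)"
      using False by (simp add: atLeast0LessThan)
    finally show "(\<Sum>n\<in>{i*d..<i*d+d}. h (n div d) (n mod d)) = (\<Sum>j<d. h i j)" .
  qed
  finally show ?thesis .
qed simp

text \<open>Here \<open>cG\<close> keeps the quadratic form of the operator positive definite,
  \<open>t\<close> is stationarity in the lower block, and \<open>t_lower\<close> says that the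
  curvature \<open>t\<close> of the off-diagonal blocks exceeds the slope \<open>1 - t * a\<close>
  towards the range of the target matrix.\<close>

locale spurious_model =
  fixes r m :: nat and a c t :: real
  assumes r: "1 \<le> r" and m: "1 \<le> m" and a: "1 \<le> a" and c: "0 < c"
    and cG: "c * (a\<^sup>2 * r + m) < 1"
    and t: "t = c * (a * r + m * t)" and t_pos: "0 < t" and t_lower: "1 < t * (1 + a)"
begin

definition d :: nat where "d = r + m"

definition g :: "nat \<Rightarrow> real" where "g i = (if i < r then - a else 1)"

definition G :: "real mat \<Rightarrow> real" where "G X = (\<Sum>i<d. g i * X $$ (i,i))"

definition gg :: real where "gg = a\<^sup>2 * r + m"

definition \<kappa> :: real where "\<kappa> = (1 - sqrt (1 - c * gg)) / gg"

text \<open>\<open>G\<close> is the inner product with the diagonal matrix of \<open>g\<close>. The operator \<open>A\<close> is the positive square root of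
  \<open>E \<mapsto> E - c G(E) diag(g)\<close>, flattened to a vector, which is where \<open>\<kappa>\<close> comes from.\<close>

definition A :: "real mat \<Rightarrow> real vec" where
  "A X = vec (d * d) (\<lambda>n. X $$ (n div d, n mod d)
           - (if n div d = n mod d then \<kappa> * g (n div d) * G X else 0))"

definition M :: "real mat" where "M = mat_diag d (\<lambda>i. if i < r then 1 else 0)"

lemma d_pos: "0 < d" using r by (simp add: d_def)

lemma gg_pos: "0 < gg"
  using m a by (auto simp: gg_def intro!: add_nonneg_pos)

lemma cgg: "c * gg < 1" using cG by (simp add: gg_def)

lemma sum_g2: "(\<Sum>i<d. (g i)\<^sup>2) = gg"
  by (simp add: d_def sum_lessThan_add g_def gg_def)

text \<open>Squaring the identity minus \<open>\<kappa>\<close> times the rank-one map of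
  \<open>g\<close> leaves the coefficient \<open>\<kappa>\<^sup>2 * gg - 2 * \<kappa>\<close>, which
  has to be \<open>- c\<close>; \<open>\<kappa>\<close> is the smaller root of this quadratic
  equation.\<close>

lemma \<kappa>_eq: "\<kappa>\<^sup>2 * gg - 2 * \<kappa> = - c"
proof -
  define w where "w = sqrt (1 - c * gg)"
  have w: "w\<^sup>2 = 1 - c * gg" using cgg by (simp add: w_def)
  have "\<kappa>\<^sup>2 * gg - 2 * \<kappa> = (w\<^sup>2 - 1) / gg"
    using gg_pos unfolding \<kappa>_def w_def[symmetric] by (simp add: power2_eq_square field_simps)
  then show ?thesis using gg_pos w by simp
qed

lemma A_carrier [simp]: "A X \<in> carrier_vec (d * d)" "dim_vec (A X) = d * d"
  by (auto simp: A_def)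

lemma div_mod_less: "n < d * d \<Longrightarrow> n div d < d \<and> n mod d < d"
  using d_pos by (auto simp: less_mult_imp_div_less)

lemma G_add: "X \<in> carrier_mat d d \<Longrightarrow> Y \<in> carrier_mat d d \<Longrightarrow> G (X + Y) = G X + G Y"
  by (simp add: G_def algebra_simps sum.distrib)

lemma G_diff: "X \<in> carrier_mat d d \<Longrightarrow> Y \<in> carrier_mat d d \<Longrightarrow> G (X - Y) = G X - G Y"
  by (simp add: G_def algebra_simps sum_subtractf)

lemma G_smult: "X \<in> carrier_mat d d \<Longrightarrow> G (x \<cdot>\<^sub>m X) = x * G X"
  by (simp add: G_def sum_distrib_left mult_ac)

lemma A_add: "X \<in> carrier_mat d d \<Longrightarrow> Y \<in> carrier_mat d d \<Longrightarrow> A (X + Y) = A X + A Y"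
  by (intro eq_vecI) (auto simp: A_def G_add div_mod_less algebra_simps)

lemma A_diff: "X \<in> carrier_mat d d \<Longrightarrow> Y \<in> carrier_mat d d \<Longrightarrow> A (X - Y) = A X - A Y"
  by (intro eq_vecI) (auto simp: A_def G_diff div_mod_less algebra_simps)

lemma A_smult: "X \<in> carrier_mat d d \<Longrightarrow> A (x \<cdot>\<^sub>m X) = x \<cdot>\<^sub>v A X"
  by (intro eq_vecI) (auto simp: A_def G_smult div_mod_less algebra_simps)

lemma A_inner:
  assumes "X \<in> carrier_mat d d" "Y \<in> carrier_mat d d"
  shows "A X \<bullet> A Y = trace_inner X Y - c * G X * G Y"
proof -
  have "A X \<bullet> A Y = (\<Sum>i<d. \<Sum>j<d. (X $$ (i,j) - (if i = j then \<kappa> * g i * G X else 0))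
       * (Y $$ (i,j) - (if i = j then \<kappa> * g i * G Y else 0)))"
    by (simp add: scalar_prod_def A_def atLeast0LessThan sum_div_mod[symmetric])
  also have "\<dots> = (\<Sum>i<d. \<Sum>j<d. X $$ (i,j) * Y $$ (i,j) + (if i = j then
      \<kappa>\<^sup>2 * G X * G Y * (g i)\<^sup>2 - \<kappa> * G Y * (g i * X $$ (i,i)) - \<kappa> * G X * (g i * Y $$ (i,i)) else 0))"
    by (intro sum.cong refl) (auto simp: algebra_simps power2_eq_square)
  also have "\<dots> = trace_inner X Y + (\<kappa>\<^sup>2 * G X * G Y * gg - \<kappa> * G Y * G X - \<kappa> * G X * G Y)"
    by (simp add: sum.distrib trace_inner_sum[OF assms] sum_subtractf sum_distrib_left[symmetric] sum_g2 G_def[symmetric])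
  also have "\<dots> = trace_inner X Y + (\<kappa>\<^sup>2 * gg - 2 * \<kappa>) * G X * G Y"
    by (simp add: algebra_simps)
  finally show ?thesis by (simp add: \<kappa>_eq)
qed

lemma A_norm:
  assumes "X \<in> carrier_mat d d"
  shows "(vec_norm2 (A X))\<^sup>2 = (frob_norm X)\<^sup>2 - c * (G X)\<^sup>2"
proof -
  have "(vec_norm2 (A X))\<^sup>2 = A X \<bullet> A X"
    by (simp add: vec_norm2_def scalar_prod_def sum_nonneg)
  also have "\<dots> = trace_inner X X - c * (G X)\<^sup>2" by (simp add: A_inner[OF assms assms] power2_eq_square)
  also have "trace_inner X X = (frob_norm X)\<^sup>2"
    unfolding frob_norm_square[OF assms] trace_inner_sum[OF assms assms] by (simp add: power2_eq_square)
  finally show ?thesis .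
qed

lemma G_bound:
  assumes "X \<in> carrier_mat d d"
  shows "(G X)\<^sup>2 \<le> gg * (frob_norm X)\<^sup>2"
proof -
  have "(G X)\<^sup>2 \<le> (\<Sum>i<d. (g i)\<^sup>2) * (\<Sum>i<d. (X $$ (i,i))\<^sup>2)"
    unfolding G_def by (rule cauchy_schwarz_sum)
  also have "\<dots> \<le> gg * (frob_norm X)\<^sup>2"
    unfolding sum_g2 frob_norm_square[OF assms] using gg_pos
    by (intro mult_left_mono sum_mono member_le_sum) auto
  finally show ?thesis .
qed

text \<open>Cauchy-Schwarz against \<open>g\<close> involves no rank, so one positive constant
  serves for every \<open>k\<close>.\<close>

lemma A_lower:
  assumes "X \<in> carrier_mat d d"
  shows "(1 - c * gg) * (frob_norm X)\<^sup>2 \<le> (vec_norm2 (A X))\<^sup>2"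
  using mult_left_mono[OF G_bound[OF assms], of c] c by (simp add: A_norm[OF assms] algebra_simps)

lemma frob_norm_pos:
  assumes "X \<in> carrier_mat d k" "X \<noteq> 0\<^sub>m d k"
  shows "0 < (frob_norm X)\<^sup>2"
proof -
  obtain i j where ij: "i < d" "j < k" "X $$ (i,j) \<noteq> 0"
    using assms by (metis carrier_matD eq_matI index_zero_mat)
  have "0 < (X $$ (i,j))\<^sup>2" using ij by simp
  also have "\<dots> \<le> (\<Sum>j<k. (X $$ (i,j))\<^sup>2)" using ij by (intro member_le_sum) auto
  also have "\<dots> \<le> (frob_norm X)\<^sup>2"
    unfolding frob_norm_square[OF assms(1)] using ij
    by (intro member_le_sum[of i "{..<d}" "\<lambda>i. \<Sum>j<k. (X $$ (i,j))\<^sup>2"]) (auto intro: sum_nonneg)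
  finally show ?thesis .
qed

lemma A_pos:
  assumes "X \<in> carrier_mat d d" "X \<noteq> 0\<^sub>m d d"
  shows "0 < (vec_norm2 (A X))\<^sup>2"
  using mult_pos_pos[OF _ frob_norm_pos[OF assms], of "1 - c * gg"] cgg A_lower[OF assms(1)] by linarith

lemma sym_mats_subset: "sym_mats d \<subseteq> carrier_mat d d" by (auto simp: sym_mats_def)

lemma mat_diag_sym: "mat_diag d h \<in> sym_mats d"
  by (auto simp: sym_mats_def mat_diag_def intro!: eq_matI)

lemma M_carrier [simp]: "M \<in> carrier_mat d d" by (simp add: M_def)

lemma G_mat_diag: "G (mat_diag d h) = (\<Sum>i<d. g i * h i)"
  by (simp add: G_def mat_diag_def)

lemma trace_inner_mat_diag:
  assumes "X \<in> carrier_mat d d"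
  shows "trace_inner (mat_diag d h) X = (\<Sum>i<d. h i * X $$ (i,i))"
  unfolding trace_inner_sum[OF mat_diag_dim assms]
proof (intro sum.cong refl)
  fix i assume i: "i \<in> {..<d}"
  have "(\<Sum>j<d. mat_diag d h $$ (i,j) * X $$ (i,j)) = (\<Sum>j<d. if i = j then h i * X $$ (i,i) else 0)"
    using i by (intro sum.cong) (auto simp: mat_diag_def)
  then show "(\<Sum>j<d. mat_diag d h $$ (i,j) * X $$ (i,j)) = h i * X $$ (i,i)" using i by simp
qed

lemma frob_norm_mat_diag: "(frob_norm (mat_diag d h))\<^sup>2 = (\<Sum>i<d. (h i)\<^sup>2)"
  unfolding frob_norm_square[OF mat_diag_dim]
  by (intro sum.cong refl) (simp add: mat_diag_def if_distrib[of "\<lambda>x. x\<^sup>2"] cong: if_cong)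

lemma rank_M: "mat_rank M = r"
proof -
  have "{i. i < d \<and> (if i < r then 1 else 0 :: real) \<noteq> 0} = {..<r}" by (auto simp: d_def)
  then show ?thesis by (simp add: M_def mat_rank_mat_diag)
qed

lemma M_psd: "M \<in> psd_mats d"
proof -
  have "0 \<le> x \<bullet> (M *\<^sub>v x)" if "x \<in> carrier_vec d" for x
  proof -
    have "x \<bullet> (M *\<^sub>v x) = (\<Sum>i<d. if i < r then (x $ i)\<^sup>2 else 0)"
      using that
      by (auto simp: M_def mat_diag_def scalar_prod_def atLeast0LessThan if_distrib[of "\<lambda>z. z * _"] power2_eq_square
          intro!: sum.cong cong: if_cong)
    also have "\<dots> \<ge> 0" by (intro sum_nonneg) auto
    finally show ?thesis .
  qed
  then show ?thesis using mat_diag_sym by (simp add: psd_mats_def M_def)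
qed

lemma trace_M: "mat_trace M = r"
  by (simp add: mat_trace_def M_def mat_diag_def d_def sum_lessThan_add)

lemma nuc_norm_M: "nuc_norm M = r"
  by (simp add: M_def nuc_norm_mat_diag d_def sum_lessThan_add)

text \<open>\<open>A\<close> preserves the norm wherever \<open>G\<close> vanishes, so such a matrix
  of rank at most one attains the upper constant 1 for every \<open>k \<ge> 1\<close>. It also
  serves as the nonzero test matrix for the lower constants.\<close>

lemma rank_one_kernel:
  obtains E where "E \<in> sym_mats d" "mat_rank E \<le> 1" "G E = 0" "frob_norm E \<noteq> 0"
proof -
  \<comment> \<open>One index from each block: the square \<open>a\<close> of the entry at
    \<open>r\<close>, with weight 1, cancels the entry 1 at index 0, with weight
    \<open>- a\<close>.\<close>
  define x :: "nat \<Rightarrow> real" where "x i = (if i = 0 then 1 else if i = r then sqrt a else 0)" for i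
  define E where "E = mat d d (\<lambda>(i,j). x i * x j)"
  interpret vec_space "TYPE(real)" d .
  have E: "E \<in> carrier_mat d d" by (simp add: E_def)
  have "rank E \<le> 1" by (rule rank_le_1_product_entries[OF E, of x x]) (simp add: E_def)
  then have "mat_rank E \<le> 1" using E by (simp add: mat_rank_def)
  moreover have "E \<in> sym_mats d" by (auto simp: sym_mats_def E_def intro!: eq_matI)
  moreover have "G E = 0"
  proof -
    have "G E = (\<Sum>i<d. (if i = 0 then - a else 0) + (if i = r then a else 0))"
      unfolding G_def using r a by (intro sum.cong refl) (auto simp: E_def x_def g_def)
    also have "\<dots> = 0" using r m by (simp add: sum.distrib d_def)
    finally show ?thesis .
  qed
  moreover have "frob_norm E \<noteq> 0"
  proof -
    have "E $$ (0,0) = 1" using d_pos by (simp add: E_def x_def)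
    then have "E \<noteq> 0\<^sub>m d d" using d_pos by auto
    from frob_norm_pos[OF E this] show ?thesis by auto
  qed
  ultimately show ?thesis using that by blast
qed

section \<open>Restricted isometry constants on both matrix spaces; the extremal matrices are
  symmetric\<close>

context
  fixes S :: "real mat set"
  assumes S: "sym_mats d \<subseteq> S" "S \<subseteq> carrier_mat d d"
begin

lemma linear_A: "linear_op S (d * d) A"
  using S(2) unfolding linear_op_def by (auto intro!: A_add A_smult)

lemma L_const_A: "1 \<le> k \<Longrightarrow> L_const S A k = 1"
proof -
  assume k: "1 \<le> k"
  obtain E where E: "E \<in> sym_mats d" "mat_rank E \<le> 1" "G E = 0" "frob_norm E \<noteq> 0"
    by (rule rank_one_kernel)
  show ?thesis
  proof (rule L_const_eqI[of _ _ _ _ E])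
    show "(vec_norm2 (A X))\<^sup>2 \<le> 1 * (frob_norm X)\<^sup>2" if "X \<in> S" for X
      using A_norm[of X] that S c by auto
  qed (use E S k A_norm[of E] in auto)
qed

lemma mu_const_pos: "1 \<le> k \<Longrightarrow> 0 < mu_const S A k"
proof -
  assume k: "1 \<le> k"
  obtain E where E: "E \<in> sym_mats d" "mat_rank E \<le> 1" "G E = 0" "frob_norm E \<noteq> 0"
    by (rule rank_one_kernel)
  have "1 - c * gg \<le> mu_const S A k"
  proof (rule mu_const_lower_bound[of _ _ _ _ E])
    show "(1 - c * gg) * (frob_norm X)\<^sup>2 \<le> (vec_norm2 (A X))\<^sup>2" if "X \<in> S" for X
      using A_lower that S by auto
  qed (use E S k cgg in auto)
  then show ?thesis using cgg by simp
qed

text \<open>The extremal \<open>E\<close> is diagonal and agrees with \<open>g\<close> on the first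
  \<open>r + r1\<close> indices; \<open>r1 \<le> m\<close> leaves room for them. Then
  \<open>G E\<close> and the squared norm of \<open>E\<close> are both \<open>N\<close>, so its
  ratio is \<open>1 - c * N\<close>.\<close>

lemma mu_const_A:
  assumes "r1 \<le> m" and mu: "c * (a\<^sup>2 * r + r1) = 1 - \<mu>" and "0 < \<mu>"
  shows "mu_const S A (r1 + r) = \<mu>"
proof -
  define h where "h i = (if i < r then - a else if i < r + r1 then 1 else 0)" for i
  define E where "E = mat_diag d h"
  define N where "N = a\<^sup>2 * r + r1"
  have N: "0 < N" using a r by (auto simp: N_def intro!: add_pos_nonneg)
  have d': "d = r + (r1 + (m - r1))" using assms(1) by (simp add: d_def)
  have GE: "G E = N"
    unfolding E_def G_mat_diag unfolding d' sum_lessThan_add by (simp add: g_def h_def N_def power2_eq_square)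
  have FE: "(frob_norm E)\<^sup>2 = N"
    unfolding E_def frob_norm_mat_diag unfolding d' sum_lessThan_add by (simp add: h_def N_def)
  show ?thesis
  proof (rule mu_const_eqI[of _ _ _ _ E])
    fix X assume X: "X \<in> S" "mat_rank X \<le> r1 + r"
    \<comment> \<open>The excess of the squared weights over 1 is \<open>a\<^sup>2 - 1\<close> on
      the first \<open>r\<close> indices and zero elsewhere; added to the rank \<open>r1 + r\<close>
      it gives \<open>N\<close>.\<close>
    have "(G X)\<^sup>2 \<le> (real (r1 + r) + (\<Sum>i<d. if i < r then a\<^sup>2 - 1 else 0)) * (frob_norm X)\<^sup>2"
      unfolding G_def using X S a by (intro low_rank_diag_bound) (auto simp: g_def)
    also have "real (r1 + r) + (\<Sum>i<d. if i < r then a\<^sup>2 - 1 else 0) = N"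
      unfolding d_def sum_lessThan_add by (simp add: N_def) (simp add: algebra_simps)
    finally have "c * (G X)\<^sup>2 \<le> (1 - \<mu>) * (frob_norm X)\<^sup>2"
      using mult_left_mono[of "(G X)\<^sup>2" "N * (frob_norm X)\<^sup>2" c] c mu
      by (simp add: N_def mult.assoc[symmetric])
    then show "\<mu> * (frob_norm X)\<^sup>2 \<le> (vec_norm2 (A X))\<^sup>2"
      using A_norm[of X] X S by (auto simp: algebra_simps)
  next
    show "E \<in> S" using S mat_diag_sym by (auto simp: E_def)
    have "{i. i < d \<and> h i \<noteq> 0} \<subseteq> {..<r1 + r}" by (auto simp: h_def)
    from card_mono[OF _ this] show "mat_rank E \<le> r1 + r" by (simp add: E_def mat_rank_mat_diag)
    have "(vec_norm2 (A E))\<^sup>2 = N * (1 - c * N)"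
      using A_norm[of E] by (simp add: E_def[symmetric] GE FE[symmetric] power2_eq_square algebra_simps)
        (simp add: E_def)
    then show "(vec_norm2 (A E))\<^sup>2 = \<mu> * (frob_norm E)\<^sup>2" using mu by (simp add: FE N_def)
    show "frob_norm E \<noteq> 0" using FE N by auto
  qed (use assms in auto)
qed

end

text \<open>The preimage of the identity under \<open>A\<^sup>* A\<close>, scaled by \<open>l\<close>.\<close>

definition Z :: "real \<Rightarrow> real mat" where
  "Z l = mat_diag d (\<lambda>i. l * (1 + c * (\<Sum>i<d. g i) / (1 - c * gg) * g i))"

lemma Z_carrier [simp]: "Z l \<in> carrier_mat d d" by (simp add: Z_def)

text \<open>The diagonal in \<open>Z\<close> comes from the Sherman-Morrison formula: it is the
  all-ones vector multiplied by the inverse of the identity minus \<open>c\<close> times the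
  rank-one map of \<open>g\<close>.\<close>

lemma A_Z_inner:
  assumes X: "X \<in> carrier_mat d d"
  shows "A (Z l) \<bullet> A X = l * mat_trace X"
proof -
  define s where "s = c * (\<Sum>i<d. g i) / (1 - c * gg)"
  have "G (Z l) = (\<Sum>i<d. l * g i + l * s * (g i)\<^sup>2)"
    unfolding Z_def G_mat_diag s_def[symmetric] by (simp add: algebra_simps power2_eq_square)
  then have GZ: "G (Z l) = l * ((\<Sum>i<d. g i) + s * gg)"
    by (simp add: sum.distrib sum_distrib_left[symmetric] sum_g2 algebra_simps)
  have s: "c * ((\<Sum>i<d. g i) + s * gg) = s"
    using cgg by (simp add: s_def field_simps)
  have "trace_inner (Z l) X = (\<Sum>i<d. l * (X $$ (i,i)) + l * s * (g i * X $$ (i,i)))"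
    unfolding Z_def s_def[symmetric] trace_inner_mat_diag[OF X] by (simp add: algebra_simps)
  also have "\<dots> = l * mat_trace X + l * s * G X"
    using X by (simp add: mat_trace_def G_def sum.distrib sum_distrib_left)
  finally have "A (Z l) \<bullet> A X = l * mat_trace X + l * s * G X - l * (c * ((\<Sum>i<d. g i) + s * gg)) * G X"
    by (simp add: A_inner[OF Z_carrier X] GZ mult_ac)
  then show ?thesis by (simp add: s)
qed

text \<open>\<open>adjoint_op\<close> is a definite description, so uniqueness is needed too: the
  difference of two candidates lies in \<open>S\<close> and is orthogonal to itself. The scaled
  identity is symmetric, so the adjoint is the same in both cases.\<close>

lemma adjoint_A_Z:
  assumes S: "sym_mats d \<subseteq> S" "S \<subseteq> carrier_mat d d"
    and S_diff: "\<And>X Y. X \<in> S \<Longrightarrow> Y \<in> S \<Longrightarrow> X - Y \<in> S"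
  shows "adjoint_op S A (A (Z l)) = l \<cdot>\<^sub>m 1\<^sub>m d"
  unfolding adjoint_op_def
proof (rule the_equality)
  have I: "l \<cdot>\<^sub>m 1\<^sub>m d \<in> sym_mats d" by (auto simp: sym_mats_def intro!: eq_matI)
  have inner: "trace_inner (l \<cdot>\<^sub>m 1\<^sub>m d) E = A (Z l) \<bullet> A E" if "E \<in> carrier_mat d d" for E
  proof -
    have "trace_inner (l \<cdot>\<^sub>m 1\<^sub>m d) E = l * mat_trace E"
    proof -
      have "l \<cdot>\<^sub>m 1\<^sub>m d = mat_diag d (\<lambda>_. l)" by (auto simp: mat_diag_def intro!: eq_matI)
      then show ?thesis using that by (simp add: trace_inner_mat_diag mat_trace_def sum_distrib_left)
    qed
    then show ?thesis by (simp add: A_Z_inner[OF that])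
  qed
  show "l \<cdot>\<^sub>m 1\<^sub>m d \<in> S \<and> (\<forall>E\<in>S. trace_inner (l \<cdot>\<^sub>m 1\<^sub>m d) E = A (Z l) \<bullet> A E)"
    using I S inner by blast
  fix X assume X: "X \<in> S \<and> (\<forall>E\<in>S. trace_inner X E = A (Z l) \<bullet> A E)"
  define D where "D = X - l \<cdot>\<^sub>m 1\<^sub>m d"
  have DS: "D \<in> S" unfolding D_def using X I S S_diff by blast
  have D: "D \<in> carrier_mat d d" using DS S by blast
  have Xc: "X \<in> carrier_mat d d" using X S by blast
  have Ic: "l \<cdot>\<^sub>m 1\<^sub>m d \<in> carrier_mat d d" by simp
  have "trace_inner X D = trace_inner (l \<cdot>\<^sub>m 1\<^sub>m d) D" using X DS inner[OF D] by simp
  moreover have "(frob_norm D)\<^sup>2 = trace_inner X D - trace_inner (l \<cdot>\<^sub>m 1\<^sub>m d) D"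
    unfolding frob_norm_square[OF D] trace_inner_sum[OF Xc D] trace_inner_sum[OF Ic D] sum_subtractf[symmetric]
    using Xc by (intro sum.cong refl) (simp add: D_def power2_eq_square algebra_simps)
  ultimately have "(frob_norm D)\<^sup>2 = 0" by simp
  then have "D = 0\<^sub>m d d" using frob_norm_pos[OF D] by force
  then have "X $$ (i,j) = (l \<cdot>\<^sub>m 1\<^sub>m d) $$ (i,j)" if "i < d" "j < d" for i j
    using that Xc unfolding D_def by (metis Ic diff_add_cancel eq_iff_diff_eq_0 index_minus_mat(1) index_zero_mat(1) carrier_matD)
  then show "X = l \<cdot>\<^sub>m 1\<^sub>m d" using Xc by (intro eq_matI) auto
qed

text \<open>Expanding the square, the cross term with the noise is \<open>l\<close> times the trace
  of \<open>X - M\<close>. The noise thus subtracts exactly the trace penalty from the noiseless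
  loss, up to a constant.\<close>

lemma lsq_loss_A:
  assumes X: "X \<in> carrier_mat d d"
  shows "lsq_loss A (A M + A (Z l)) X =
    (1/2) * (vec_norm2 (A (X - M)))\<^sup>2 - l * mat_trace X + (l * r + (1/2) * (vec_norm2 (A (Z l)))\<^sup>2)"
proof -
  let ?x = "A (X - M)" and ?z = "A (Z l)"
  have D: "X - M \<in> carrier_mat d d" by (rule minus_carrier_mat[OF M_carrier])
  have sq: "(vec_norm2 v)\<^sup>2 = v \<bullet> v" for v :: "real vec"
    by (simp add: vec_norm2_def scalar_prod_def sum_nonneg)
  have "A X - (A M + ?z) = ?x - ?z"
    unfolding A_diff[OF X M_carrier] by (intro eq_vecI) (auto simp: algebra_simps)
  then have "(vec_norm2 (A X - (A M + ?z)))\<^sup>2 = (?x - ?z) \<bullet> (?x - ?z)" by (simp add: sq)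
  also have "\<dots> = ?x \<bullet> ?x - 2 * (?z \<bullet> ?x) + ?z \<bullet> ?z"
    using A_carrier(2)[of "X - M"] A_carrier(2)[of "Z l"]
    by (simp add: scalar_prod_def algebra_simps sum_subtractf sum.distrib sum_distrib_left)
  also have "?z \<bullet> ?x = l * (mat_trace X - r)"
  proof -
    have "mat_trace (X - M) = mat_trace X - mat_trace M"
      using carrier_matD[OF X] carrier_matD[OF M_carrier] by (simp add: mat_trace_def sum_subtractf)
    then show ?thesis by (simp add: A_Z_inner[OF D] trace_M)
  qed
  finally show ?thesis
    by (simp add: lsq_loss_def sq[symmetric] algebra_simps)
qed

lemma A_diff_pos:
  assumes "X \<in> carrier_mat d d" "X \<noteq> M"
  shows "0 < (vec_norm2 (A (X - M)))\<^sup>2"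
proof (rule A_pos)
  show "X - M \<noteq> 0\<^sub>m d d"
  proof
    assume eq: "X - M = 0\<^sub>m d d"
    have "X $$ (i,j) = M $$ (i,j)" if "i < d" "j < d" for i j
      using arg_cong[OF eq, of "\<lambda>D. D $$ (i,j)"] that carrier_matD[OF M_carrier] by simp
    then have "X = M" using carrier_matD[OF assms(1)] carrier_matD[OF M_carrier] by (intro eq_matI) auto
    then show False using assms by simp
  qed
qed (rule minus_carrier_mat[OF M_carrier])

lemma A_zero: "(vec_norm2 (A (M - M)))\<^sup>2 = 0"
proof -
  have "A (M - M) = 0\<^sub>v (d * d)"
    unfolding A_diff[OF M_carrier M_carrier] by (rule minus_cancel_vec) simp
  then show ?thesis by (simp add: vec_norm2_def)
qed

text \<open>After the cancellation the penalty is \<open>l\<close> times the gap between nuclear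
  norm and trace, which is nonnegative and zero at \<open>M\<close>; the quadratic part is strictly
  positive away from \<open>M\<close>.\<close>

lemma unique_min_asym:
  assumes "0 \<le> l"
  shows "unique_global_min_on (carrier_mat d d)
    (\<lambda>X. lsq_loss A (A M + A (Z l)) X + l * nuc_norm X) M"
  unfolding unique_global_min_on_def
proof (intro conjI ballI impI M_carrier)
  fix Y assume Y: "Y \<in> carrier_mat d d" "Y \<noteq> M"
  have "l * mat_trace Y \<le> l * nuc_norm Y"
    using assms trace_le_nuc_norm[OF Y(1)] by (rule mult_left_mono[rotated])
  then show "lsq_loss A (A M + A (Z l)) M + l * nuc_norm M < lsq_loss A (A M + A (Z l)) Y + l * nuc_norm Y"
    unfolding lsq_loss_A[OF M_carrier] lsq_loss_A[OF Y(1)]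
    unfolding A_zero trace_M nuc_norm_M using A_diff_pos[OF Y] by linarith
qed

text \<open>The trace penalty cancels completely and only the definite quadratic part and a constant
  remain.\<close>

lemma unique_min_sym:
  "unique_global_min_on (psd_mats d) (\<lambda>X. lsq_loss A (A M + A (Z l)) X + l * mat_trace X) M"
  unfolding unique_global_min_on_def
proof (intro conjI ballI impI M_psd)
  fix Y assume Y: "Y \<in> psd_mats d" "Y \<noteq> M"
  then have Yc: "Y \<in> carrier_mat d d" by (auto simp: psd_mats_def sym_mats_def)
  show "lsq_loss A (A M + A (Z l)) M + l * mat_trace M < lsq_loss A (A M + A (Z l)) Y + l * mat_trace Y"
    unfolding lsq_loss_A[OF M_carrier] lsq_loss_A[OF Yc]
    unfolding A_zero using A_diff_pos[OF Yc Y(2)] by linarith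
qed

section \<open>The nonzero local minimum of the factored objectives\<close>

definition U0 :: "real mat" where "U0 = mat d m (\<lambda>(i,k). spurious t r i k)"

lemma U0_carrier [simp]: "U0 \<in> carrier_mat d m" by (simp add: U0_def)

lemma U0_nonzero: "U0 \<noteq> 0\<^sub>m d m"
proof -
  have "U0 $$ (r, 0) = sqrt t" using m by (simp add: U0_def spurious_def d_def)
  then show ?thesis using t_pos m by (auto simp: d_def)
qed

lemma M_sym: "M\<^sup>T = M"
  using mat_diag_sym by (simp add: M_def sym_mats_def)

lemma M_U0: "M * U0 = 0\<^sub>m d m"
proof (intro eq_matI)
  fix i k assume "i < dim_row (0\<^sub>m d m :: real mat)" "k < dim_col (0\<^sub>m d m :: real mat)"
  then have ik: "i < d" "k < m" by auto
  have "(M * U0) $$ (i,k) = (\<Sum>j<d. M $$ (i,j) * U0 $$ (j,k))"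
    using ik carrier_matD[OF M_carrier] carrier_matD[OF U0_carrier]
    by (simp add: scalar_prod_def atLeast0LessThan)
  also have "\<dots> = 0"
    using ik by (intro sum.neutral) (auto simp: M_def mat_diag_def U0_def spurious_def)
  finally show "(M * U0) $$ (i,k) = 0\<^sub>m d m $$ (i,k)" using ik by simp
qed (use carrier_matD[OF M_carrier] carrier_matD[OF U0_carrier] in auto)

lemma U0_M: "U0\<^sup>T * M = 0\<^sub>m m d"
proof -
  have "U0\<^sup>T * M = (M * U0)\<^sup>T"
    by (simp add: transpose_mult[OF M_carrier U0_carrier] M_sym)
  then show ?thesis by (simp add: M_U0)
qed

lemma norm_factor_loss:
  assumes U: "U \<in> carrier_mat d m" and V: "V \<in> carrier_mat d m"
  shows "(vec_norm2 (A (U * V\<^sup>T - M)))\<^sup>2 = factor_loss c a r m (\<lambda>i k. U $$ (i,k)) (\<lambda>i k. V $$ (i,k))"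
proof -
  have UV: "(U * V\<^sup>T) $$ (i,j) = (\<Sum>k<m. U $$ (i,k) * V $$ (j,k))" if "i < d" "j < d" for i j
    using that U V by (simp add: scalar_prod_def atLeast0LessThan)
  have E: "(U * V\<^sup>T - M) $$ (i,j) = (\<Sum>k<m. U $$ (i,k) * V $$ (j,k)) - (if i = j \<and> i < r then 1 else 0)"
    if "i < d" "j < d" for i j
  proof -
    have "(U * V\<^sup>T - M) $$ (i,j) = (U * V\<^sup>T) $$ (i,j) - M $$ (i,j)"
      using that carrier_matD[OF M_carrier] by simp
    then show ?thesis using that by (simp only: UV) (auto simp: M_def mat_diag_def)
  qed
  have D: "U * V\<^sup>T - M \<in> carrier_mat d d" by (rule minus_carrier_mat[OF M_carrier])
  have F: "(frob_norm (U * V\<^sup>T - M))\<^sup>2 =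
     (\<Sum>i<d. \<Sum>j<d. ((\<Sum>k<m. U $$ (i,k) * V $$ (j,k)) - (if i = j \<and> i < r then 1 else 0))\<^sup>2)"
    unfolding frob_norm_square[OF D] by (intro sum.cong refl) (simp only: E lessThan_iff)
  have G: "G (U * V\<^sup>T - M) = (\<Sum>i<d. (if i < r then - a else 1) * ((\<Sum>k<m. U $$ (i,k) * V $$ (i,k)) - (if i < r then 1 else 0)))"
    unfolding G_def g_def by (intro sum.cong refl) (simp only: E lessThan_iff simp_thms)
  show ?thesis unfolding A_norm[OF D] F G factor_loss_def d_def ..
qed

lemma trace_mult_transpose:
  assumes U: "U \<in> carrier_mat d m" and V: "V \<in> carrier_mat d m"
  shows "mat_trace (U * V\<^sup>T) = (\<Sum>i<d. \<Sum>k<m. U $$ (i,k) * V $$ (i,k))"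
  unfolding mat_trace_def using U V by (auto simp: scalar_prod_def atLeast0LessThan intro!: sum.cong)

text \<open>The squared norms of the factors minus twice the trace of \<open>U * V\<^sup>T\<close>
  complete the square to the squared norm of \<open>U - V\<close>.\<close>

lemma f_asym_eq:
  assumes U: "U \<in> carrier_mat d m" and V: "V \<in> carrier_mat d m"
  shows "f_asym (lsq_loss A (A M + A (Z l))) l (U, V) =
    (1/2) * factor_loss c a r m (\<lambda>i k. U $$ (i,k)) (\<lambda>i k. V $$ (i,k))
    + l/2 * (\<Sum>i<d. \<Sum>k<m. (U $$ (i,k) - V $$ (i,k))\<^sup>2) + (l * r + (1/2) * (vec_norm2 (A (Z l)))\<^sup>2)"
proof -
  have UV: "U * V\<^sup>T \<in> carrier_mat d d" using U V by simp
  have eq: "(\<Sum>i<d. \<Sum>k<m. (U $$ (i,k) - V $$ (i,k))\<^sup>2)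
     = (frob_norm U)\<^sup>2 + (frob_norm V)\<^sup>2 - 2 * mat_trace (U * V\<^sup>T)"
    unfolding frob_norm_square[OF U] frob_norm_square[OF V] trace_mult_transpose[OF U V]
    by (simp add: power2_diff sum.distrib sum_subtractf sum_distrib_left mult.assoc)
  show ?thesis
    unfolding f_asym_def prod.case lsq_loss_A[OF UV] norm_factor_loss[OF U V] eq
    by (simp add: algebra_simps)
qed

text \<open>One radius for independent \<open>U\<close> and \<open>V\<close> serves both cases, the
  symmetric one being \<open>U = V\<close>.\<close>

lemma factor_loss_local_radius:
  obtains e where "0 < e" "\<And>U V. U \<in> carrier_mat d m \<Longrightarrow> V \<in> carrier_mat d m \<Longrightarrow>
    (frob_dist U0 U)\<^sup>2 \<le> e\<^sup>2 \<Longrightarrow> (frob_dist U0 V)\<^sup>2 \<le> e\<^sup>2 \<Longrightarrow>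
    factor_loss c a r m (\<lambda>i k. U0 $$ (i,k)) (\<lambda>i k. U0 $$ (i,k))
      \<le> factor_loss c a r m (\<lambda>i k. U $$ (i,k)) (\<lambda>i k. V $$ (i,k))"
proof -
  define K where "K = 4 * sqrt t + 2 * c * a * (2 * sqrt t * sqrt m + 1) + c * a\<^sup>2"
  define \<eta> where "\<eta> = t * (1 + a) - 1"
  \<comment> \<open>The quotient makes the error \<open>e * K\<close> at most twice the curvature
    margin \<open>\<eta>\<close>; the cap 1 is what linearized the second-order errors.\<close>
  define e where "e = min 1 (2 * \<eta> / K)"
  have K: "0 < K" using t_pos c a unfolding K_def by (intro add_pos_nonneg) auto
  have \<eta>: "0 < \<eta>" using t_lower by (simp add: \<eta>_def)
  have e: "0 < e" "e \<le> 1" using K \<eta> by (auto simp: e_def)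
  have "e * K \<le> (2 * \<eta> / K) * K" using K by (intro mult_right_mono) (auto simp: e_def)
  then have small: "e * K \<le> 2 * \<eta>" using K by simp
  have cm: "c * m < 1"
  proof -
    have "c * m \<le> c * (a\<^sup>2 * r + m)" using c by (intro mult_left_mono) auto
    then show ?thesis using cG by linarith
  qed
  \<comment> \<open>Stationarity solved for \<open>t\<close> gives
    \<open>t * (1 - c * m) = c * a * r\<close>; multiplied by \<open>a\<close>, this falls under
    \<open>cG\<close>.\<close>
  have ta: "t * a < 1"
  proof -
    have "t * (1 - c * m) = c * a * r" using t by (simp add: algebra_simps)
    then have "t * a * (1 - c * m) = c * a\<^sup>2 * r"
      by (metis mult.assoc mult.commute power2_eq_square)
    also have "\<dots> < 1 * (1 - c * m)" using cG by (simp add: algebra_simps)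
    finally show ?thesis using cm by simp
  qed
  have dist: "(frob_dist U0 W)\<^sup>2 = (\<Sum>i<r+m. \<Sum>k<m. (W $$ (i,k) - spurious t r i k)\<^sup>2)"
    if "W \<in> carrier_mat d m" for W
  proof -
    have D: "U0 - W \<in> carrier_mat d m" by (rule minus_carrier_mat[OF that])
    show ?thesis unfolding frob_dist_def frob_norm_square[OF D] d_def[symmetric]
      using that by (intro sum.cong refl) (simp add: U0_def power2_commute)
  qed
  have U0e: "factor_loss c a r m (\<lambda>i k. U0 $$ (i,k)) (\<lambda>i k. U0 $$ (i,k))
     = factor_loss c a r m (spurious t r) (spurious t r)"
    unfolding factor_loss_def d_def[symmetric] by (simp add: U0_def cong: sum.cong_simp)
  show ?thesis
  proof (rule that[OF e(1)])
    fix U V assume UV: "U \<in> carrier_mat d m" "V \<in> carrier_mat d m"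
      "(frob_dist U0 U)\<^sup>2 \<le> e\<^sup>2" "(frob_dist U0 V)\<^sup>2 \<le> e\<^sup>2"
    show "factor_loss c a r m (\<lambda>i k. U0 $$ (i,k)) (\<lambda>i k. U0 $$ (i,k))
      \<le> factor_loss c a r m (\<lambda>i k. U $$ (i,k)) (\<lambda>i k. V $$ (i,k))"
      unfolding U0e
      by (rule factor_loss_local_bound[where e = e])
        (use UV small e c a m cm t t_pos ta in \<open>simp_all add: dist K_def \<eta>_def\<close>)
  qed
qed

text \<open>The term in \<open>U - V\<close> vanishes at \<open>(U0, U0)\<close> and is nonnegative
  elsewhere, so minimality of the factored loss is enough.\<close>

lemma local_min_asym:
  assumes l: "0 \<le> l"
  shows "local_min_on frob_dist_pair (carrier_mat d m \<times> carrier_mat d m)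
    (f_asym (lsq_loss A (A M + A (Z l))) l) (U0, U0)"
proof -
  obtain e where e: "0 < e" "\<And>U V. U \<in> carrier_mat d m \<Longrightarrow> V \<in> carrier_mat d m \<Longrightarrow>
    (frob_dist U0 U)\<^sup>2 \<le> e\<^sup>2 \<Longrightarrow> (frob_dist U0 V)\<^sup>2 \<le> e\<^sup>2 \<Longrightarrow>
    factor_loss c a r m (\<lambda>i k. U0 $$ (i,k)) (\<lambda>i k. U0 $$ (i,k))
      \<le> factor_loss c a r m (\<lambda>i k. U $$ (i,k)) (\<lambda>i k. V $$ (i,k))"
    using factor_loss_local_radius by blast
  show ?thesis unfolding local_min_on_def
  proof (intro conjI exI[of _ e] ballI impI)
    fix P assume P: "P \<in> carrier_mat d m \<times> carrier_mat d m" and dist: "frob_dist_pair (U0, U0) P < e"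
    obtain U V where UV: "P = (U, V)" "U \<in> carrier_mat d m" "V \<in> carrier_mat d m" using P by auto
    have "(frob_dist U0 U)\<^sup>2 + (frob_dist U0 V)\<^sup>2 \<le> e\<^sup>2"
      using dist e(1) unfolding UV frob_dist_pair_def by (simp add: real_sqrt_less_iff sqrt_le_D less_imp_le)
    then have d1: "(frob_dist U0 U)\<^sup>2 \<le> e\<^sup>2" and d2: "(frob_dist U0 V)\<^sup>2 \<le> e\<^sup>2"
      using zero_le_power2[of "frob_dist U0 U"] zero_le_power2[of "frob_dist U0 V"] by linarith+
    have "0 \<le> l / 2 * (\<Sum>i<d. \<Sum>k<m. (U $$ (i,k) - V $$ (i,k))\<^sup>2)"
      using l by (intro mult_nonneg_nonneg sum_nonneg) auto
    then show "f_asym (lsq_loss A (A M + A (Z l))) l (U0, U0) \<le> f_asym (lsq_loss A (A M + A (Z l))) l P"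
      unfolding UV(1) f_asym_eq[OF U0_carrier U0_carrier] f_asym_eq[OF UV(2,3)]
      using e(2)[OF UV(2,3) d1 d2] by simp
  qed (use e in auto)
qed

text \<open>The symmetric objective is the asymmetric one on the diagonal \<open>U = V\<close>,
  where the term in \<open>U - V\<close> is zero.\<close>

lemma local_min_sym:
  "local_min_on frob_dist (carrier_mat d m) (f_sym (lsq_loss A (A M + A (Z l))) l) U0"
proof -
  obtain e where e: "0 < e" "\<And>U V. U \<in> carrier_mat d m \<Longrightarrow> V \<in> carrier_mat d m \<Longrightarrow>
    (frob_dist U0 U)\<^sup>2 \<le> e\<^sup>2 \<Longrightarrow> (frob_dist U0 V)\<^sup>2 \<le> e\<^sup>2 \<Longrightarrow>
    factor_loss c a r m (\<lambda>i k. U0 $$ (i,k)) (\<lambda>i k. U0 $$ (i,k))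
      \<le> factor_loss c a r m (\<lambda>i k. U $$ (i,k)) (\<lambda>i k. V $$ (i,k))"
    using factor_loss_local_radius by blast
  have eq: "f_sym \<phi> l U = f_asym \<phi> l (U, U)" for \<phi> U
    by (simp add: f_sym_def f_asym_def)
  show ?thesis unfolding local_min_on_def
  proof (intro conjI exI[of _ e] ballI impI)
    fix U assume U: "U \<in> carrier_mat d m" and dist: "frob_dist U0 U < e"
    have "0 \<le> frob_dist U0 U"
    proof -
      have D: "U0 - U \<in> carrier_mat d m" by (rule minus_carrier_mat[OF U])
      show ?thesis unfolding frob_dist_def frob_norm_def trace_inner_sum[OF D D] by (simp add: sum_nonneg)
    qed
    then have "(frob_dist U0 U)\<^sup>2 \<le> e\<^sup>2" using dist by (intro power_mono) auto
    then show "f_sym (lsq_loss A (A M + A (Z l))) l U0 \<le> f_sym (lsq_loss A (A M + A (Z l))) l U"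
      unfolding eq f_asym_eq[OF U0_carrier U0_carrier] f_asym_eq[OF U U]
      using e(2)[OF U U] by simp
  qed (use e in auto)
qed

lemma singular_value_M: "singular_value M 1 = 1" "singular_value M r = 1"
  unfolding M_def d_def using r by (simp_all add: singular_value_partial_identity)

section \<open>The asymmetric and the symmetric case for one model\<close>

lemma counterexample_asym:
  assumes "r1 \<le> m" "c * (a\<^sup>2 * r + r1) = 1 - \<mu>" "0 < \<mu>"
  shows "M \<in> carrier_mat d d \<and> mat_rank M = r \<and>
    singular_value M 1 = 1 \<and> singular_value M r = 1 \<and>
    linear_op (carrier_mat d d) (d * d) A \<and>
    (\<forall>k\<ge>1. L_const (carrier_mat d d) A k = 1 \<and> 0 < mu_const (carrier_mat d d) A k) \<and>
    mu_const (carrier_mat d d) A (r1 + r) = \<mu> \<and>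
    (\<forall>l::real. 0 \<le> l \<longrightarrow>
      (\<exists>\<xi> \<in> carrier_vec (d * d).
        op_norm (adjoint_op (carrier_mat d d) A \<xi>) = l \<and>
        (let b = A M + \<xi>; \<phi> = lsq_loss A b in
          unique_global_min_on (carrier_mat d d) (\<lambda>X. \<phi> X + l * nuc_norm X) M \<and>
          (\<exists>U V. local_min_on frob_dist_pair (carrier_mat d m \<times> carrier_mat d m)
                    (f_asym \<phi> l) (U, V) \<and>
                 U \<noteq> 0\<^sub>m d m \<and> V \<noteq> 0\<^sub>m d m \<and>
                 transpose_mat U * M = 0\<^sub>m m d \<and> M * V = 0\<^sub>m d m))))"
proof -
  have full: "sym_mats d \<subseteq> carrier_mat d d" "carrier_mat d d \<subseteq> carrier_mat d d"
    using sym_mats_subset by auto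
  have full_diff: "X - Y \<in> carrier_mat d d" if "X \<in> carrier_mat d d" "Y \<in> carrier_mat d d" for X Y :: "real mat"
    by (rule minus_carrier_mat[OF that(2)])
  show ?thesis
  proof (intro conjI allI impI M_carrier rank_M singular_value_M)
    show "linear_op (carrier_mat d d) (d * d) A" by (rule linear_A[OF full])
    show "mu_const (carrier_mat d d) A (r1 + r) = \<mu>"
      by (rule mu_const_A[OF full assms])
    fix k :: nat assume k: "1 \<le> k"
    show "L_const (carrier_mat d d) A k = 1" by (rule L_const_A[OF full k])
    show "0 < mu_const (carrier_mat d d) A k" by (rule mu_const_pos[OF full k])
  next
    fix l :: real assume l: "0 \<le> l"
    have op: "op_norm (adjoint_op (carrier_mat d d) A (A (Z l))) = l"
      using op_norm_scaled_identity[OF l d_pos] adjoint_A_Z[OF full full_diff] by simp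
    show "\<exists>\<xi> \<in> carrier_vec (d * d).
          op_norm (adjoint_op (carrier_mat d d) A \<xi>) = l \<and>
          (let b = A M + \<xi>; \<phi> = lsq_loss A b in
            unique_global_min_on (carrier_mat d d) (\<lambda>X. \<phi> X + l * nuc_norm X) M \<and>
            (\<exists>U V. local_min_on frob_dist_pair (carrier_mat d m \<times> carrier_mat d m)
                      (f_asym \<phi> l) (U, V) \<and>
                   U \<noteq> 0\<^sub>m d m \<and> V \<noteq> 0\<^sub>m d m \<and>
                   transpose_mat U * M = 0\<^sub>m m d \<and> M * V = 0\<^sub>m d m))"
      unfolding Let_def
      by (intro bexI[of _ "A (Z l)"] conjI exI[of _ U0] op unique_min_asym[OF l]
          local_min_asym[OF l] U0_nonzero U0_M M_U0 A_carrier(1))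
  qed
qed

lemma counterexample_sym:
  assumes "r1 \<le> m" "c * (a\<^sup>2 * r + r1) = 1 - \<mu>" "0 < \<mu>"
  shows "M \<in> psd_mats d \<and> mat_rank M = r \<and>
    singular_value M 1 = 1 \<and> singular_value M r = 1 \<and>
    linear_op (sym_mats d) (d * d) A \<and>
    (\<forall>k\<ge>1. L_const (sym_mats d) A k = 1 \<and> 0 < mu_const (sym_mats d) A k) \<and>
    mu_const (sym_mats d) A (r1 + r) = \<mu> \<and>
    (\<forall>l::real. 0 \<le> l \<longrightarrow>
      (\<exists>\<xi> \<in> carrier_vec (d * d).
        op_norm (adjoint_op (sym_mats d) A \<xi>) = l \<and>
        (let b = A M + \<xi>; \<phi> = lsq_loss A b in
          unique_global_min_on (psd_mats d) (\<lambda>X. \<phi> X + l * mat_trace X) M \<and>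
          (\<exists>U. local_min_on frob_dist (carrier_mat d m) (f_sym \<phi> l) U \<and>
               U \<noteq> 0\<^sub>m d m \<and> M * U = 0\<^sub>m d m))))"
proof -
  have sym: "sym_mats d \<subseteq> sym_mats d" "sym_mats d \<subseteq> carrier_mat d d"
    using sym_mats_subset by auto
  have sym_diff: "X - Y \<in> sym_mats d" if "X \<in> sym_mats d" "Y \<in> sym_mats d" for X Y
    using that by (auto simp: sym_mats_def transpose_minus)
  show ?thesis
  proof (intro conjI allI impI M_psd rank_M singular_value_M)
    show "linear_op (sym_mats d) (d * d) A" by (rule linear_A[OF sym])
    show "mu_const (sym_mats d) A (r1 + r) = \<mu>"
      by (rule mu_const_A[OF sym assms])
    fix k :: nat assume k: "1 \<le> k"
    show "L_const (sym_mats d) A k = 1" by (rule L_const_A[OF sym k])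
    show "0 < mu_const (sym_mats d) A k" by (rule mu_const_pos[OF sym k])
  next
    fix l :: real assume l: "0 \<le> l"
    have op: "op_norm (adjoint_op (sym_mats d) A (A (Z l))) = l"
      using op_norm_scaled_identity[OF l d_pos] adjoint_A_Z[OF sym sym_diff] by simp
    show "\<exists>\<xi> \<in> carrier_vec (d * d).
          op_norm (adjoint_op (sym_mats d) A \<xi>) = l \<and>
          (let b = A M + \<xi>; \<phi> = lsq_loss A b in
            unique_global_min_on (psd_mats d) (\<lambda>X. \<phi> X + l * mat_trace X) M \<and>
            (\<exists>U. local_min_on frob_dist (carrier_mat d m) (f_sym \<phi> l) U \<and>
                 U \<noteq> 0\<^sub>m d m \<and> M * U = 0\<^sub>m d m))"
      unfolding Let_def
      by (intro bexI[of _ "A (Z l)"] conjI exI[of _ U0] op unique_min_sym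
          local_min_sym U0_nonzero M_U0 A_carrier(1))
  qed
qed

end

section \<open>Choice of the parameters\<close>

lemma spurious_model_exists:
  fixes \<mu> :: real and r1 rs r2 :: nat
  assumes mu: "0 < \<mu>" "\<mu> < 1" and rs: "1 \<le> rs" "rs \<le> r1"
    and r2: "real r2 \<ge> (real rs * \<mu> + real r1) / (1 - \<mu>)"
  obtains a c t where "spurious_model rs r2 a c t" "c * (a\<^sup>2 * rs + r1) = 1 - \<mu>" "r1 \<le> r2"
proof -
  have r2': "rs * \<mu> + r1 \<le> r2 * (1 - \<mu>)" using r2 mu by (simp add: field_simps)
  have rsmu: "0 < rs * \<mu>" using rs mu by simp
  have "r2 * (1 - \<mu>) \<le> real r2" using mu by (simp add: algebra_simps)
  then have r12: "real r1 < real r2" using r2' rsmu by linarith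
  \<comment> \<open>With \<open>c\<close> fixed by \<open>\<mu>\<close>, the condition
    \<open>cG\<close> is equivalent to \<open>a\<^sup>2 > b\<close>; the hypothesis on
    \<open>r2\<close> is equivalent to \<open>b \<ge> 1\<close>.\<close>
  define b where "b = (r2 * (1 - \<mu>) - r1) / (rs * \<mu>)"
  \<comment> \<open>The curvature condition is equivalent to
    \<open>a\<^sup>2 < b + a * (1 - \<mu>) / \<mu>\<close>. As \<open>a \<ge> 1\<close>, half of
    \<open>(1 - \<mu>) / \<mu>\<close> stays strictly inside the admissible range.\<close>
  define \<epsilon> where "\<epsilon> = (1 - \<mu>) / (2 * \<mu>)"
  define a where "a = sqrt (b + \<epsilon>)"
  have b1: "1 \<le> b" using r2' rsmu by (simp add: b_def le_divide_eq)
  have eps: "0 < \<epsilon>" using mu by (simp add: \<epsilon>_def)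
  have a2: "a\<^sup>2 = b + \<epsilon>" using b1 eps by (simp add: a_def)
  have a1: "1 \<le> a" using b1 eps by (simp add: a_def)
  define D where "D = a\<^sup>2 * rs + r1"
  have D: "0 < D" using a1 rs by (auto simp: D_def intro!: add_pos_nonneg)
  define c where "c = (1 - \<mu>) / D"
  have c: "0 < c" using mu D by (simp add: c_def)
  have cD: "c * D = 1 - \<mu>" using D by (simp add: c_def)
  have brs: "b * rs * \<mu> = r2 * (1 - \<mu>) - r1" using rs mu by (simp add: b_def)
  have ers: "\<epsilon> * rs * \<mu> = rs * (1 - \<mu>) / 2" using mu by (simp add: \<epsilon>_def)
  have a2rs: "a\<^sup>2 * rs * \<mu> = r2 * (1 - \<mu>) - r1 + rs * (1 - \<mu>) / 2"
    unfolding a2 using brs ers by (simp add: algebra_simps)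
  have rsp: "0 < rs * (1 - \<mu>)" using rs mu by simp
  have cG: "c * (a\<^sup>2 * rs + r2) < 1"
  proof -
    have "(1 - \<mu>) * (a\<^sup>2 * rs + r2) < D"
      using a2rs rsp unfolding D_def by (simp add: algebra_simps)
    then show ?thesis using D by (simp add: c_def divide_less_eq)
  qed
  \<comment> \<open>This is \<open>1 < t * (1 + a)\<close> with the value of \<open>t\<close>
    inserted and the denominator \<open>1 - c * r2\<close> cleared.\<close>
  have lower: "1 < c * (a\<^sup>2 * rs + a * rs + r2)"
  proof -
    have "rs * (1 - \<mu>) \<le> a * (rs * (1 - \<mu>))" using mult_right_mono[OF a1, of "rs * (1 - \<mu>)"] rsp by simp
    moreover have "(1 - \<mu>) * (a\<^sup>2 * rs + a * rs + r2)
        = D + (r2 * (1 - \<mu>) - r1 - a\<^sup>2 * rs * \<mu>) + a * (rs * (1 - \<mu>))"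
      unfolding D_def by (simp add: algebra_simps)
    ultimately have "D < (1 - \<mu>) * (a\<^sup>2 * rs + a * rs + r2)"
      using a2rs rsp by linarith
    then show ?thesis using D by (simp add: c_def less_divide_eq)
  qed
  have cm: "c * r2 < 1"
  proof -
    have "c * r2 \<le> c * (a\<^sup>2 * rs + r2)" using c by (intro mult_left_mono) auto
    then show ?thesis using cG by linarith
  qed
  \<comment> \<open>Solution of the stationarity equation, which is affine in \<open>t\<close>;
    \<open>cm\<close> makes the denominator positive.\<close>
  define t where "t = c * a * rs / (1 - c * r2)"
  have t: "t * (1 - c * r2) = c * a * rs" using cm by (simp add: t_def)
  have "spurious_model rs r2 a c t"
  proof
    show "0 < t" using cm c a1 rs by (simp add: t_def)
    show "t = c * (a * rs + r2 * t)" using t by (simp add: algebra_simps)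
    have "(1 - c * r2) * 1 < c * a * rs * (1 + a)" using lower by (simp add: algebra_simps power2_eq_square)
    also have "\<dots> = (1 - c * r2) * (t * (1 + a))" using t by (simp add: mult_ac)
    finally show "1 < t * (1 + a)" using cm by (simp add: mult_less_cancel_left_pos)
    show "1 \<le> r2" using r12 rs by linarith
  qed (use rs a1 c cG in auto)
  then show ?thesis using that cD r12 unfolding D_def by auto
qed

theorem theorem6:
  fixes \<mu> :: real and r1 rs r2 :: nat
  assumes "0 < \<mu>" and "\<mu> < 1"
    and "1 \<le> rs" and "rs \<le> r1"
    and "real r2 \<ge> (real rs * \<mu> + real r1) / (1 - \<mu>)"
  shows
    "(\<exists>(d::nat) (n::nat) (M :: real mat) (A :: real mat \<Rightarrow> real vec).
        M \<in> carrier_mat d d \<and> mat_rank M = rs \<and>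
        singular_value M 1 = 1 \<and> singular_value M rs = 1 \<and>
        linear_op (carrier_mat d d) n A \<and>
        (\<forall>k\<ge>1. L_const (carrier_mat d d) A k = 1 \<and> 0 < mu_const (carrier_mat d d) A k) \<and>
        mu_const (carrier_mat d d) A (r1 + rs) = \<mu> \<and>
        (\<forall>l::real. 0 \<le> l \<longrightarrow>
          (\<exists>\<xi> \<in> carrier_vec n.
            op_norm (adjoint_op (carrier_mat d d) A \<xi>) = l \<and>
            (let b = A M + \<xi>; \<phi> = lsq_loss A b in
              unique_global_min_on (carrier_mat d d) (\<lambda>X. \<phi> X + l * nuc_norm X) M \<and>
              (\<exists>U V. local_min_on frob_dist_pair (carrier_mat d r2 \<times> carrier_mat d r2)
                        (f_asym \<phi> l) (U, V) \<and>
                     U \<noteq> 0\<^sub>m d r2 \<and> V \<noteq> 0\<^sub>m d r2 \<and>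
                     transpose_mat U * M = 0\<^sub>m r2 d \<and> M * V = 0\<^sub>m d r2)))))
     \<and>
     (\<exists>(d::nat) (n::nat) (M :: real mat) (A :: real mat \<Rightarrow> real vec).
        M \<in> psd_mats d \<and> mat_rank M = rs \<and>
        singular_value M 1 = 1 \<and> singular_value M rs = 1 \<and>
        linear_op (sym_mats d) n A \<and>
        (\<forall>k\<ge>1. L_const (sym_mats d) A k = 1 \<and> 0 < mu_const (sym_mats d) A k) \<and>
        mu_const (sym_mats d) A (r1 + rs) = \<mu> \<and>
        (\<forall>l::real. 0 \<le> l \<longrightarrow>
          (\<exists>\<xi> \<in> carrier_vec n.
            op_norm (adjoint_op (sym_mats d) A \<xi>) = l \<and>
            (let b = A M + \<xi>; \<phi> = lsq_loss A b in
              unique_global_min_on (psd_mats d) (\<lambda>X. \<phi> X + l * mat_trace X) M \<and>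
              (\<exists>U. local_min_on frob_dist (carrier_mat d r2) (f_sym \<phi> l) U \<and>
                   U \<noteq> 0\<^sub>m d r2 \<and> M * U = 0\<^sub>m d r2)))))"
proof -
  obtain a c t where model: "spurious_model rs r2 a c t"
    and *: "r1 \<le> r2" "c * (a\<^sup>2 * rs + r1) = 1 - \<mu>" "0 < \<mu>"
    using spurious_model_exists[OF assms] assms(1) by blast
  show ?thesis
    \<comment> \<open>The existential witnesses stay schematic and are fixed by unification with the
      two lemmas of the model, so that the number of measurements is the square of the
      dimension.\<close>
    by (rule conjI; (rule exI)+)
       (rule spurious_model.counterexample_asym[OF model *] spurious_model.counterexample_sym[OF model *])+
qed

end
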